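(* Let $\nu\ge 2$ be an integer. The $\nu$-level correlation measure $\mathcal{R}^{(\nu)}$ of the sequence $(\mathcal{F}_Q)_{Q\ge 1}$ of Farey fractions exists; that is, the limit $$\mathcal{R}^{(\nu)}(\mathcal{B})=\lim_{Q\to\infty}\mathcal{R}^{(\nu)}_{\mathcal{F}_Q}(\mathcal{B})$$ exists for every box $\mathcal{B}\subset\mathbb{R}^{\nu-1}$. Moreover, for every $\Lambda>0$ and every box $\mathcal{B}\subset(0,\Lambda)^{\nu-1}$, $$\mathcal{R}^{(\nu)}(\mathcal{B})=2\sum_{\substack{A,B\in\mathbb{N}^{\nu-1}\\ (A_j,B_j)=1,\ j=1,\dots,\nu-1}}\operatorname{area}\big(\Omega_{A,B,\Lambda}\cap\Phi_{A,B}^{-1}(\mathcal{B})\big).$$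
   Context: Farey fractions: for an integer $Q\ge1$, $\mathcal{F}_Q$ is the set of Farey fractions of order $Q$ in $[0,1]$, with the convention that $\#\mathcal{F}_Q=N_Q=\sum_{k=1}^Q\varphi(k)$ ($\varphi$ is Euler's function), i.e. $\mathcal{F}_Q=\{a/q: 1\le a\le q\le Q,\ \gcd(a,q)=1\}$. A box in $\mathbb{R}^{\nu-1}$ is a product of $\nu-1$ bounded intervals. $\mathbb{N}=\{1,2,3,\dots\}$, $(A_j,B_j)$ denotes the greatest common divisor, and area is Lebesgue measure in $\mathbb{R}^2$. Correlation measures: for a finite set $F\subset[0,1]$ with $N$ elements and a box $\mathcal{B}\subset\mathbb{R}^{\nu-1}$, $$\mathcal{R}^{(\nu)}_F(\mathcal{B})=\frac1N\,\#\Big\{(x_1,\dots,x_\nu)\in F^\nu:\ x_i \text{ distinct},\ (x_1-x_2,x_2-x_3,\dots,x_{\nu-1}-x_\nu)\in\tfrac1N\mathcal{B}+\mathbb{Z}^{\nu-1}\Big\}.$$ For an increasing sequence $(F_n)_n$ of finite subsets of $[0,1]$, if $\mathcal{R}^{(\nu)}(\mathcal{B})=\lim_n\mathcal{R}^{(\nu)}_{F_n}(\mathcal{B})$ exists for every box $\mathcal{B}\subset\mathbb{R}^{\nu-1}$, then $\mathcal{R}^{(\nu)}$ is called the $\nu$-level correlation measure of $(F_n)_n$. For $\Lambda>0$ and $A=(A_1,\dots,A_{\nu-1})$, $B=(B_1,\dots,B_{\nu-1})\in\mathbb{N}^{\nu-1}$ define $$\Omega_{A,B,\Lambda}=\Big\{(x,y)\in\mathbb{R}^2:\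 0\le x\le y\le1,\ y\ge\tfrac{3}{\pi^2\Lambda},\ yA-xB\in(0,1]^{\nu-1}\Big\},$$ $$T_{A,B}(x,y)=\frac{3}{\pi^2}\left(\frac{B_1}{y(A_1y-B_1x)},\dots,\frac{B_{\nu-1}}{y(A_{\nu-1}y-B_{\nu-1}x)}\right)$$ (all denominators are nonzero on $\Omega_{A,B,\Lambda}$). Let $T:\mathbb{R}^{\nu-1}\to\mathbb{R}^{\nu-1}$ be the linear map $$T(x_1,\dots,x_{\nu-1})=(x_1-x_2,\,x_2-x_3,\,\dots,\,x_{\nu-2}-x_{\nu-1},\,x_{\nu-1}),$$ and set $\Phi_{A,B}=T\circ T_{A,B}$. Thus $\Omega_{A,B,\Lambda}\cap\Phi_{A,B}^{-1}(\mathcal{B})=\{(x,y)\in\Omega_{A,B,\Lambda}:\Phi_{A,B}(x,y)\in\mathcal{B}\}$. *)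

theory Defs
  imports "HOL-Analysis.Analysis"
begin

text \<open>
  A point of \<open>\<real>\<^sup>d\<close> is an extensional function on the index set \<open>{1..d}\<close>, that is, an element
  of \<open>{1..d} \<rightarrow>\<^sub>E UNIV\<close>, so that tuples correspond to functions one-to-one; likewise
  \<open>\<nu>\<close>-tuples from \<open>F\<close> and multi-indices in \<open>\<nat>\<^sup>d\<close>, where \<open>\<nat>\<close> starts at 1.
\<close>

definition farey :: "nat \<Rightarrow> real set" where
  "farey Q = {real a / real q | a q. 1 \<le> a \<and> a \<le> q \<and> q \<le> Q \<and> coprime a q}"

definition is_box :: "nat \<Rightarrow> (nat \<Rightarrow> real) set \<Rightarrow> bool" where
  "is_box d \<B> \<longleftrightarrow>
     (\<exists>I. (\<forall>j\<in>{1..d}. is_interval (I j) \<and> bounded (I j)) \<and> \<B> = Pi\<^sub>E {1..d} I)"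

definition correlation :: "nat \<Rightarrow> real set \<Rightarrow> (nat \<Rightarrow> real) set \<Rightarrow> real" where
  "correlation \<nu> F \<B> =
     real (card {x \<in> {1..\<nu>} \<rightarrow>\<^sub>E F. inj_on x {1..\<nu>} \<and>
       (\<exists>b\<in>\<B>. \<exists>k :: nat \<Rightarrow> int. \<forall>j\<in>{1..\<nu> - 1}.
          x j - x (j + 1) = b j / real (card F) + of_int (k j))}) / real (card F)"

text \<open>
  The values of \<open>R\<close> outside boxes are irrelevant.
\<close>

definition is_correlation_measure ::
    "nat \<Rightarrow> (nat \<Rightarrow> real set) \<Rightarrow> ((nat \<Rightarrow> real) set \<Rightarrow> real) \<Rightarrow> bool" where
  "is_correlation_measure \<nu> F R \<longleftrightarrow>
     incseq F \<and> (\<forall>n. finite (F n) \<and> F n \<subseteq> {0..1}) \<and>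
     (\<forall>\<B>. is_box (\<nu> - 1) \<B> \<longrightarrow> (\<lambda>n. correlation \<nu> (F n) \<B>) \<longlonglongrightarrow> R \<B>)"

definition Omega :: "nat \<Rightarrow> (nat \<Rightarrow> nat) \<Rightarrow> (nat \<Rightarrow> nat) \<Rightarrow> real \<Rightarrow> (real \<times> real) set" where
  "Omega d A B \<Lambda> =
     {(x, y). 0 \<le> x \<and> x \<le> y \<and> y \<le> 1 \<and> y \<ge> 3 / (pi\<^sup>2 * \<Lambda>) \<and>
        (\<forall>j\<in>{1..d}. y * real (A j) - x * real (B j) \<in> {0<..1})}"

definition T_AB :: "nat \<Rightarrow> (nat \<Rightarrow> nat) \<Rightarrow> (nat \<Rightarrow> nat) \<Rightarrow> real \<times> real \<Rightarrow> nat \<Rightarrow> real" where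
  "T_AB d A B = (\<lambda>(x, y). \<lambda>j\<in>{1..d}.
     3 / pi\<^sup>2 * (real (B j) / (y * (real (A j) * y - real (B j) * x))))"

definition T_lin :: "nat \<Rightarrow> (nat \<Rightarrow> real) \<Rightarrow> nat \<Rightarrow> real" where
  "T_lin d v = (\<lambda>j\<in>{1..d}. if j < d then v j - v (j + 1) else v j)"

definition Phi :: "nat \<Rightarrow> (nat \<Rightarrow> nat) \<Rightarrow> (nat \<Rightarrow> nat) \<Rightarrow> real \<times> real \<Rightarrow> nat \<Rightarrow> real" where
  "Phi d A B = T_lin d \<circ> T_AB d A B"

definition coprime_pairs :: "nat \<Rightarrow> ((nat \<Rightarrow> nat) \<times> (nat \<Rightarrow> nat)) set" where
  "coprime_pairs d =
     {(A, B). A \<in> {1..d} \<rightarrow>\<^sub>E {1..} \<and> B \<in> {1..d} \<rightarrow>\<^sub>E {1..} \<and>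
        (\<forall>j\<in>{1..d}. coprime (A j) (B j))}"

end

theory Submission
  imports Defs "HOL-Computational_Algebra.Squarefree"
begin

text \<open>
  Measure a tuple of Farey fractions of order \<open>Q\<close> from its last entry \<open>a/n\<close>, and let \<open>m \<in> {1..n}\<close> be the
  inverse of \<open>a\<close> modulo \<open>n\<close>. The vectors \<open>(a, n)\<close> and \<open>((a m - 1)/n, m)\<close> form a basis of \<open>\<int>\<^sup>2\<close>, so a
  reduced fraction \<open>a'/q\<close>, read as the primitive vector \<open>(a', q)\<close>, is
  \<open>A (a, n) - B ((a m - 1)/n, m)\<close> for exactly one coprime pair \<open>(A, B)\<close>. Then \<open>q = A n - B m\<close> and
  \<open>a'/q - a/n = B / (n (A n - B m))\<close>. Thus all differences in the tuple are determined by the pairs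
  \<open>(A\<^sub>j, B\<^sub>j)\<close> and by \<open>(m, n)\<close>, and they are homogeneous of degree \<open>-2\<close> in \<open>(m, n)\<close>. For fixed pairs
  \<open>(A\<^sub>j, B\<^sub>j)\<close> the tuples counted by the correlation correspond to the coprime \<open>(m, n)\<close> for which
  \<open>(m/Q, n/Q)\<close> lies in a planar region (\<open>correlation_farey_eq\<close>). The last entry itself has index
  \<open>(1, 0)\<close>, so the difference between the last two entries has the same form as the others. Because the
  box is bounded, only finitely many families of pairs have a nonempty region (\<open>index_bound\<close>).

  Coprime pairs are equidistributed: the number of coprime \<open>(m, n)\<close> with \<open>(m/Q, n/Q)\<close> in a region is
  asymptotically \<open>6/\<pi>\<^sup>2\<close> times its area times \<open>Q\<^sup>2\<close> (\<open>LIMSEQ_visible_count\<close>), while the number of Farey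
  fractions is asymptotically \<open>3/\<pi>\<^sup>2\<close> times \<open>Q\<^sup>2\<close>. The quotient of the two constants is the factor 2.
  Moebius inversion reduces the count of coprime pairs to sums over all lattice points; such a sum is the
  integral of a step function, and dominated convergence gives its limit.

  The regions still depend on \<open>Q\<close>, through the quotient of the number of Farey fractions by
  \<open>Q\<^sup>2\<close>, which only tends to \<open>3/\<pi>\<^sup>2\<close>. The equidistribution is therefore proved for
  sets that vary with \<open>Q\<close> and converge in a sense (\<open>converges_ae\<close>) that is also stable under moving the points slightly. For the regions it
  holds off finitely many lines and conics (\<open>converges_ae_region\<close>).

  For a general box the differences have either sign, and \<open>A\<^sub>j\<close>, \<open>B\<^sub>j\<close> are integers. A box with
  positive sides forces the lifted fractions to decrease along the tuple, which makes all
  \<open>A\<^sub>j\<close>, \<open>B\<^sub>j\<close> with \<open>j < \<nu>\<close> positive and all indices different; the regions are then the sets of the area formula (\<open>Omega_Phi_eq_region\<close>).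
\<close>

section \<open>The Moebius function\<close>

definition moebius_mu :: "nat \<Rightarrow> real" where
  "moebius_mu n = (if squarefree n then (- 1) ^ card (prime_factors n) else 0)"

lemma abs_moebius_le: "\<bar>moebius_mu n\<bar> \<le> 1"
  by (simp add: moebius_mu_def power_abs)

lemma sum_minus_one_card_Pow:
  assumes "finite A"
  shows "(\<Sum>X\<in>Pow A. (- 1 :: real) ^ card X) = (if A = {} then 1 else 0)"
  using assms prod_diff_conv_sum[of A "\<lambda>_. 1 :: real" "\<lambda>_. 1"]
  by (cases "A = {}") (simp_all add: power_0_left)

text \<open>
  The squarefree divisors of \<open>n\<close> are the products of the subsets of its prime factors, and the signs
  cancel over the subsets of a nonempty set.
\<close>

lemma sum_moebius_divisors:
  assumes "n > 0"
  shows "(\<Sum>d | d dvd n. moebius_mu d) = (if n = 1 then 1 else 0)"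
proof -
  have fin: "finite {d. d dvd n}" using assms by simp
  have "(\<Sum>d | d dvd n. moebius_mu d) = (\<Sum>d | d dvd n \<and> squarefree d. (- 1) ^ card (prime_factors d))"
    by (rule sum.mono_neutral_cong_right) (use fin in \<open>auto simp: moebius_mu_def\<close>)
  also have "\<dots> = (\<Sum>X\<in>Pow (prime_factors n). (- 1) ^ card X)"
  proof (rule sum.reindex_bij_witness[of _ "\<lambda>X. \<Prod>X" prime_factors])
    fix d assume d: "d \<in> {d. d dvd n \<and> squarefree d}"
    then have "d \<noteq> 0" using assms by auto
    have "\<Prod>(prime_factors d) = (\<Prod>p\<in>prime_factors d. p ^ multiplicity p d)"
      using d \<open>d \<noteq> 0\<close> by (intro prod.cong) (auto simp: squarefree_factorial_semiring')
    then show "\<Prod>(prime_factors d) = d"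
      using \<open>d \<noteq> 0\<close> by (simp add: prime_factorization_nat[symmetric])
    show "prime_factors d \<in> Pow (prime_factors n)"
      using d assms dvd_prime_factors[of n d] by auto
    show "(- 1 :: real) ^ card (prime_factors d) = (- 1) ^ card (prime_factors d)" ..
  next
    fix X assume "X \<in> Pow (prime_factors n)"
    then have X: "finite X" "\<And>p. p \<in> X \<Longrightarrow> prime p" "X \<subseteq> prime_factors n"
      by (auto intro: finite_subset)
    have "prime_factorization (\<Prod>X) = (\<Sum>p\<in>X. prime_factorization p)"
      using X by (subst prime_factorization_prod) (auto intro: prime_gt_0_nat)
    also have "\<dots> = (\<Sum>p\<in>X. {#p#})"
      by (rule sum.cong) (auto simp: prime_factorization_prime X)
    also have "\<dots> = mset_set X"
      by simp
    finally have pf: "prime_factorization (\<Prod>X) = mset_set X" .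
    then show *: "prime_factors (\<Prod>X) = X" using X by simp
    have "\<Prod>X dvd \<Prod>(prime_factors n)"
      by (rule prod_dvd_prod_subset) (use X in auto)
    also have "\<dots> dvd n"
    proof -
      have "\<Prod>(prime_factors n) dvd (\<Prod>p\<in>prime_factors n. p ^ multiplicity p n)"
        by (rule prod_dvd_prod) (auto simp: dvd_power prime_factors_multiplicity)
      then show ?thesis using assms by (simp add: prime_factorization_nat[symmetric])
    qed
    finally have "\<Prod>X dvd n" .
    moreover have "squarefree (\<Prod>X)"
      by (rule squarefree_prod_coprime) (use X in \<open>auto intro: primes_coprime squarefree_prime\<close>)
    ultimately show "\<Prod>X \<in> {d. d dvd n \<and> squarefree d}" by simp
  qed
  also have "\<dots> = (if prime_factors n = {} then 1 else 0)"
    by (rule sum_minus_one_card_Pow) simp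
  also have "prime_factors n = {} \<longleftrightarrow> n = 1"
    using assms by (auto simp: prime_factorization_empty_iff)
  finally show ?thesis .
qed

section \<open>Lattice sums as integrals of step functions\<close>

text \<open>
  Coprimality of \<open>m\<close> and \<open>n\<close> is detected by summing the Moebius function over their common divisors \<open>e\<close>.
  Exchanging the sums leaves, for each \<open>e\<close>, all lattice points of the square shrunk by \<open>e\<close>.
\<close>

lemma sum_coprime_moebius:
  fixes f :: "nat \<Rightarrow> nat \<Rightarrow> real"
  shows "(\<Sum>(m,n)\<in>{(m,n). m \<in> {1..Q} \<and> n \<in> {1..Q} \<and> coprime m n}. f m n) =
    (\<Sum>e\<in>{1..Q}. moebius_mu e * (\<Sum>(m,n)\<in>{1..Q div e} \<times> {1..Q div e}. f (e * m) (e * n)))"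
proof -
  let ?S = "{1..Q} \<times> {1..Q}"
  have "(\<Sum>(m,n)\<in>{(m,n). m \<in> {1..Q} \<and> n \<in> {1..Q} \<and> coprime m n}. f m n)
      = (\<Sum>z\<in>?S. (if coprime (fst z) (snd z) then f (fst z) (snd z) else 0))"
    by (rule sum.mono_neutral_cong_left) auto
  also have "\<dots> = (\<Sum>z\<in>?S. \<Sum>e\<in>{1..Q}. if e dvd fst z \<and> e dvd snd z
                              then moebius_mu e * f (fst z) (snd z) else 0)"
  proof (rule sum.cong)
    fix z assume z: "z \<in> ?S"
    define g where "g = gcd (fst z) (snd z)"
    have g: "g > 0" "g \<le> Q" using z by (auto simp: g_def intro: order_trans[OF gcd_le1_nat])
    have sub: "{e. e dvd g} \<subseteq> {1..Q}"
    proof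
      fix e assume "e \<in> {e. e dvd g}"
      then have "e > 0" "e \<le> g" using g by (auto intro: dvd_imp_le dvd_pos_nat)
      then show "e \<in> {1..Q}" using g by simp
    qed
    have "(if coprime (fst z) (snd z) then f (fst z) (snd z) else 0)
        = (\<Sum>e | e dvd g. moebius_mu e) * f (fst z) (snd z)"
      using sum_moebius_divisors[OF g(1)] by (auto simp: g_def coprime_iff_gcd_eq_1)
    also have "\<dots> = (\<Sum>e\<in>{1..Q}. if e dvd fst z \<and> e dvd snd z
                              then moebius_mu e * f (fst z) (snd z) else 0)"
      unfolding sum_distrib_right
      by (rule sum.mono_neutral_cong_left) (use sub in \<open>auto simp: g_def\<close>)
    finally show "(if coprime (fst z) (snd z) then f (fst z) (snd z) else 0) = \<dots>" .
  qed simp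
  also have "\<dots> = (\<Sum>e\<in>{1..Q}. \<Sum>z\<in>?S. if e dvd fst z \<and> e dvd snd z
                              then moebius_mu e * f (fst z) (snd z) else 0)"
    by (rule sum.swap)
  also have "\<dots> = (\<Sum>e\<in>{1..Q}. moebius_mu e *
        (\<Sum>(m,n)\<in>{1..Q div e} \<times> {1..Q div e}. f (e * m) (e * n)))"
  proof (rule sum.cong)
    fix e assume e: "e \<in> {1..Q}"
    let ?T = "{z \<in> ?S. e dvd fst z \<and> e dvd snd z}"
    have "(\<Sum>z\<in>?S. if e dvd fst z \<and> e dvd snd z then moebius_mu e * f (fst z) (snd z) else 0)
       = moebius_mu e * (\<Sum>z\<in>?T. f (fst z) (snd z))"
      by (subst sum_distrib_left, rule sum.mono_neutral_cong_right) auto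
    also have "(\<Sum>z\<in>?T. f (fst z) (snd z)) =
        (\<Sum>z\<in>{1..Q div e} \<times> {1..Q div e}. f (e * fst z) (e * snd z))"
      by (rule sum.reindex_bij_witness[of _ "\<lambda>z. (e * fst z, e * snd z)"
            "\<lambda>z. (fst z div e, snd z div e)"])
         (use e in \<open>auto simp: div_le_mono less_eq_div_iff_mult_less_eq mult.commute
            intro!: Nat.gr0I elim!: dvdE\<close>)
    finally show "(\<Sum>z\<in>?S. if e dvd fst z \<and> e dvd snd z then moebius_mu e * f (fst z) (snd z) else 0)
       = moebius_mu e * (\<Sum>(m,n)\<in>{1..Q div e} \<times> {1..Q div e}. f (e * m) (e * n))"
      by (simp add: case_prod_unfold)
  qed simp
  finally show ?thesis .
qed

lemma ceiling_cell_iff: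
  fixes x h :: real
  assumes "h > 0" "m \<ge> 1"
  shows "x \<in> {h * (real m - 1)<..h * real m} \<longleftrightarrow> nat \<lceil>x / h\<rceil> = m"
proof -
  have "nat \<lceil>x / h\<rceil> = m \<longleftrightarrow> \<lceil>x / h\<rceil> = int m" using assms(2) by linarith
  also have "\<dots> \<longleftrightarrow> real m - 1 < x / h \<and> x / h \<le> real m"
    by (simp add: ceiling_eq_iff)
  also have "\<dots> \<longleftrightarrow> x \<in> {h * (real m - 1)<..h * real m}"
    using assms(1) by (auto simp: field_simps)
  finally show ?thesis ..
qed

lemma has_integral_rectangle_Ioc:
  fixes a b c d :: real
  assumes "a \<le> b" "c \<le> d"
  shows "has_bochner_integral lborel (indicator ({a<..b} \<times> {c<..d}) :: real \<times> real \<Rightarrow> real)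
           ((b - a) * (d - c))"
proof -
  have e: "emeasure (lborel :: (real \<times> real) measure) ({a<..b} \<times> {c<..d}) = ennreal ((b - a) * (d - c))"
    unfolding lborel_prod[symmetric]
    by (subst lborel.emeasure_pair_measure_Times) (use assms in \<open>auto simp: ennreal_mult\<close>)
  have "{a<..b} \<times> {c<..d} \<in> sets (lborel :: (real \<times> real) measure)"
    unfolding lborel_prod[symmetric] by (intro pair_measureI) auto
  from has_bochner_integral_real_indicator[OF this] e assms show ?thesis
    by (simp add: measure_def)
qed

text \<open>
  Rounding each point up to the next point of \<open>h \<int>\<^sup>2\<close> gives a function that is constant on the half-open cells of
  the lattice. Its integral is the lattice sum weighted by the cell area \<open>h\<^sup>2\<close>, and it is measurable because it is
  a finite combination of indicators of cells.
\<close>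

lemma lattice_sum_eq_integral:
  fixes g :: "real \<times> real \<Rightarrow> real" and h :: real and K :: nat
  assumes h: "h > 0"
  defines "G \<equiv> (\<lambda>p. indicator ({0<..h * real K} \<times> {0<..h * real K}) p *
                   g (h * of_int \<lceil>fst p / h\<rceil>, h * of_int \<lceil>snd p / h\<rceil>))"
  shows "has_bochner_integral lborel G
           (h\<^sup>2 * (\<Sum>(m,n)\<in>{1..K} \<times> {1..K}. g (h * real m, h * real n)))"
proof -
  define cell where "cell = (\<lambda>m::nat. {h * (real m - 1)<..h * real m})"
  have "has_bochner_integral lborel
     (\<lambda>p. \<Sum>z\<in>{1..K} \<times> {1..K}. g (h * real (fst z), h * real (snd z)) * indicator (cell (fst z) \<times> cell (snd z)) p)
     (\<Sum>z\<in>{1..K} \<times> {1..K}. g (h * real (fst z), h * real (snd z)) * h\<^sup>2)"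
  proof (intro has_bochner_integral_sum has_bochner_integral_mult_right)
    fix z :: "nat \<times> nat"
    have "(h * real (fst z) - h * (real (fst z) - 1)) * (h * real (snd z) - h * (real (snd z) - 1)) = h\<^sup>2"
      by (simp add: algebra_simps power2_eq_square)
    then show "has_bochner_integral lborel (indicator (cell (fst z) \<times> cell (snd z)) :: real \<times> real \<Rightarrow> real) (h\<^sup>2)"
      using has_integral_rectangle_Ioc[of "h * (real (fst z) - 1)" "h * real (fst z)"
           "h * (real (snd z) - 1)" "h * real (snd z)"] h
      by (simp add: cell_def)
  qed
  also have "(\<lambda>p. \<Sum>z\<in>{1..K} \<times> {1..K}. g (h * real (fst z), h * real (snd z)) *
       indicator (cell (fst z) \<times> cell (snd z)) p) = G"
  proof
    fix p :: "real \<times> real"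
    define z0 where "z0 = (nat \<lceil>fst p / h\<rceil>, nat \<lceil>snd p / h\<rceil>)"
    have "(\<Sum>z\<in>{1..K} \<times> {1..K}. g (h * real (fst z), h * real (snd z)) *
             indicator (cell (fst z) \<times> cell (snd z)) p)
        = (\<Sum>z\<in>{1..K} \<times> {1..K}. if z = z0 then g (h * real (fst z), h * real (snd z)) else 0)"
      by (rule sum.cong) (use h in \<open>auto simp: z0_def cell_def ceiling_cell_iff indicator_def
            mem_Times_iff prod_eq_iff simp del: greaterThanAtMost_iff\<close>)
    also have "\<dots> = (if z0 \<in> {1..K} \<times> {1..K} then g (h * real (fst z0), h * real (snd z0)) else 0)"
      by (subst sum.delta) auto
    also have "\<dots> = G p"
    proof -
      have range: "nat \<lceil>x / h\<rceil> \<in> {1..K} \<longleftrightarrow> x \<in> {0<..h * real K}" for x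
      proof -
        have "nat \<lceil>x / h\<rceil> \<in> {1..K} \<longleftrightarrow> 0 < \<lceil>x / h\<rceil> \<and> \<lceil>x / h\<rceil> \<le> int K" by auto linarith+
        also have "\<dots> \<longleftrightarrow> 0 < x / h \<and> x / h \<le> real K" by (simp add: ceiling_le_iff)
        also have "\<dots> \<longleftrightarrow> x \<in> {0<..h * real K}" using h by (auto simp: field_simps)
        finally show ?thesis .
      qed
      have "z0 \<in> {1..K} \<times> {1..K} \<longleftrightarrow> p \<in> {0<..h * real K} \<times> {0<..h * real K}"
        using range[of "fst p"] range[of "snd p"] by (simp only: z0_def mem_Times_iff fst_conv snd_conv)
      moreover have "real (fst z0) = of_int \<lceil>fst p / h\<rceil>" "real (snd z0) = of_int \<lceil>snd p / h\<rceil>"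
        if "z0 \<in> {1..K} \<times> {1..K}" using that by (auto simp: z0_def)
      ultimately show ?thesis by (auto simp: G_def indicator_def)
    qed
    finally show "(\<Sum>z\<in>{1..K} \<times> {1..K}. g (h * real (fst z), h * real (snd z)) *
             indicator (cell (fst z) \<times> cell (snd z)) p) = G p" .
  qed
  also have "(\<Sum>z\<in>{1..K} \<times> {1..K}. g (h * real (fst z), h * real (snd z)) * h\<^sup>2) =
      h\<^sup>2 * (\<Sum>(m,n)\<in>{1..K} \<times> {1..K}. g (h * real m, h * real n))"
    by (simp add: case_prod_unfold sum_distrib_left mult.commute)
  finally show ?thesis .
qed

text \<open>
  Fubini: the zero set is closed, and almost all of its horizontal slices are finite.
\<close>

lemma AE_lborel_slices:
  fixes F :: "real \<times> real \<Rightarrow> real"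
  assumes F: "continuous_on UNIV F" and E: "countable E"
    and fin: "\<And>y. y \<notin> E \<Longrightarrow> finite {x. F (x, y) = 0}"
  shows "AE p in lborel. F p \<noteq> 0"
proof -
  define Z where "Z = {p. F p = 0}"
  have Zb: "Z \<in> sets lborel" using borel_measurable_continuous_onI[OF F] by (auto simp: Z_def)
  then have Z: "Z \<in> sets (lborel \<Otimes>\<^sub>M (lborel :: real measure))"
    by (simp only: lborel_prod)
  have "AE y in lborel. y \<notin> E"
    by (rule AE_I'[of E]) (use E in \<open>auto intro: countable_imp_null_set_lborel\<close>)
  then have AE: "AE y in lborel. emeasure lborel ((\<lambda>x. (x, y)) -` Z) = 0"
  proof eventually_elim
    case (elim y)
    have "(\<lambda>x. (x, y)) -` Z = {x. F (x, y) = 0}" by (auto simp: Z_def)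
    with fin[OF elim] show ?case by (auto intro: emeasure_lborel_countable countable_finite)
  qed
  have "emeasure lborel Z = (\<integral>\<^sup>+y. emeasure lborel ((\<lambda>x. (x, y)) -` Z) \<partial>lborel)"
    using lborel_pair.emeasure_pair_measure_alt2[OF Z] by (simp add: lborel_prod)
  also have "\<dots> = (\<integral>\<^sup>+y. 0 \<partial>(lborel :: real measure))"
    by (rule nn_integral_cong_AE) (use AE in auto)
  finally have "Z \<in> null_sets lborel" using Zb by (auto simp: null_sets_def)
  then show ?thesis by (rule AE_I') (auto simp: Z_def)
qed

section \<open>Equidistribution of coprime pairs\<close>

definition visible_count :: "nat \<Rightarrow> (real \<times> real) set \<Rightarrow> nat" where
  "visible_count Q S = card {(m, n). m \<in> {1..Q} \<and> n \<in> {1..Q} \<and> coprime m n \<and>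
     (real m / real Q, real n / real Q) \<in> S}"

text \<open>
  The indicator functions of the sets converge continuously at almost every point. Pointwise convergence
  would not suffice, because the sets are evaluated at lattice points that only approximate \<open>p\<close>.
  A constant sequence satisfies this when its set has a null boundary.
\<close>

definition converges_ae :: "(nat \<Rightarrow> (real \<times> real) set) \<Rightarrow> (real \<times> real) set \<Rightarrow> bool" where
  "converges_ae S' S \<longleftrightarrow> (AE p in lborel. \<forall>u. u \<longlonglongrightarrow> p \<longrightarrow> (\<forall>\<^sub>F Q in sequentially. u Q \<in> S' Q \<longleftrightarrow> p \<in> S))"

lemma LIMSEQ_nat_div:
  assumes "e > 0"
  shows "(\<lambda>Q. real (Q div e) / real Q) \<longlonglongrightarrow> 1 / real e"
proof (rule tendsto_sandwich)
  show "\<forall>\<^sub>F Q in sequentially. real (Q div e) / real Q \<le> 1 / real e"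
    using eventually_gt_at_top[of 0]
  proof eventually_elim
    case (elim Q)
    have "real (Q div e * e) \<le> real Q" by (simp del: of_nat_mult)
    then show ?case using elim assms by (simp add: field_simps)
  qed
  show "\<forall>\<^sub>F Q in sequentially. 1 / real e - 1 / real Q \<le> real (Q div e) / real Q"
    using eventually_gt_at_top[of 0]
  proof eventually_elim
    case (elim Q)
    have "Q < (Q div e + 1) * e" using assms by (metis Suc_eq_plus1 dividend_less_times_div mult.commute mult_Suc_right add.commute)
    then have "real Q \<le> (real (Q div e) + 1) * real e"
      by (metis less_imp_le of_nat_1 of_nat_add of_nat_le_iff of_nat_mult)
    then have "real Q / real e - 1 \<le> real (Q div e)" using assms by (simp add: field_simps)
    then have "(real Q / real e - 1) / real Q \<le> real (Q div e) / real Q"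
      by (rule divide_right_mono) simp
    then show ?case using elim by (simp add: diff_divide_distrib)
  qed
  show "(\<lambda>Q. 1 / real e - 1 / real Q) \<longlonglongrightarrow> 1 / real e"
    using tendsto_diff[OF tendsto_const lim_1_over_n] by simp
qed simp

lemma div_square_bound:
  assumes "e > 0" "v \<le> real ((Q div e)\<^sup>2)"
  shows "v / (real Q)\<^sup>2 \<le> inverse ((real e)\<^sup>2)"
proof -
  have "((Q div e) * e)\<^sup>2 \<le> Q\<^sup>2" by (intro power_mono) simp_all
  then have "real ((Q div e)\<^sup>2) * (real e)\<^sup>2 \<le> (real Q)\<^sup>2"
    by (metis of_nat_le_iff of_nat_mult of_nat_power power_mult_distrib)
  moreover have "v * (real e)\<^sup>2 \<le> real ((Q div e)\<^sup>2) * (real e)\<^sup>2"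
    using assms(2) by (rule mult_right_mono) simp
  ultimately have "v * (real e)\<^sup>2 \<le> (real Q)\<^sup>2" by linarith
  then show ?thesis using assms(1) by (cases "Q = 0") (auto simp: field_simps)
qed

lemma AE_coord_ne: "AE p in lborel. fst p \<noteq> (a :: real) \<and> snd p \<noteq> (b :: real)"
proof -
  have "AE p in (lborel :: (real \<times> real) measure). fst p - a \<noteq> 0"
    by (rule AE_lborel_slices[of "\<lambda>p. fst p - a" "{}"]) (auto intro!: continuous_intros)
  moreover have "AE p in (lborel :: (real \<times> real) measure). snd p - b \<noteq> 0"
    by (rule AE_lborel_slices[of "\<lambda>p. snd p - b" "{b}"]) (auto intro!: continuous_intros)
  ultimately show ?thesis by eventually_elim auto
qed

text \<open>
  The sum is an integral of a step function with mesh \<open>e/Q\<close>; continuous convergence gives the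
  pointwise limit almost everywhere, and the unit square dominates. The bound, uniform in \<open>Q\<close>, is the
  majorant for summing over \<open>e\<close>.
\<close>

lemma LIMSEQ_rescaled_lattice_sum:
  fixes S' :: "nat \<Rightarrow> (real \<times> real) set"
  assumes S: "S \<in> sets borel" "S \<subseteq> {0..1} \<times> {0..1}" and conv: "converges_ae S' S" and e: "e > 0"
  defines "s \<equiv> (\<lambda>Q. \<Sum>(m,n)\<in>{1..Q div e} \<times> {1..Q div e}.
                  indicator (S' Q) (real (e * m) / real Q, real (e * n) / real Q) :: real)"
  shows "(\<lambda>Q. s Q / (real Q)\<^sup>2) \<longlonglongrightarrow> measure lborel S / (real e)\<^sup>2"
    and "\<bar>s Q / (real Q)\<^sup>2\<bar> \<le> inverse ((real e)\<^sup>2)"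
proof -
  \<comment> \<open>The successor avoids the degenerate mesh at \<open>Q = 0\<close>.\<close>
  define h where "h = (\<lambda>Q. real e / real (Suc Q))"
  define r where "r = (\<lambda>Q. h Q * real (Suc Q div e))"
  define G where "G = (\<lambda>Q p. indicator ({0<..r Q} \<times> {0<..r Q}) p *
      (indicator (S' (Suc Q)) (h Q * of_int \<lceil>fst p / h Q\<rceil>, h Q * of_int \<lceil>snd p / h Q\<rceil>) :: real))"
  have h: "h Q > 0" for Q using e by (simp add: h_def)
  have "real (Q div e * e) \<le> real Q" for Q by (simp del: of_nat_mult)
  then have r1: "r Q \<le> 1" for Q
    using e by (simp add: h_def r_def field_simps del: of_nat_Suc)
  have int: "has_bochner_integral lborel (G Q) ((h Q)\<^sup>2 * s (Suc Q))" for Q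
    using lattice_sum_eq_integral[OF h[of Q], where K = "Suc Q div e" and g = "indicator (S' (Suc Q))"]
    by (simp add: G_def r_def s_def h_def del: of_nat_Suc)
  have sq: "has_bochner_integral lborel (indicator ({0<..1} \<times> {0<..1}) :: real \<times> real \<Rightarrow> real) 1"
    using has_integral_rectangle_Ioc[of 0 1 0 1] by simp
  have hs: "(h Q)\<^sup>2 * s (Suc Q) = (real e)\<^sup>2 * (s (Suc Q) / (real (Suc Q))\<^sup>2)" for Q
    by (simp add: h_def power_divide)
  have h0: "h \<longlonglongrightarrow> 0"
    unfolding h_def by (rule LIMSEQ_Suc[OF lim_const_over_n])
  have rlim: "r \<longlonglongrightarrow> 1"
  proof -
    have "(\<lambda>Q. real e * (real (Suc Q div e) / real (Suc Q))) \<longlonglongrightarrow> real e * (1 / real e)"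
      by (intro tendsto_intros LIMSEQ_Suc[OF LIMSEQ_nat_div[OF e]])
    then show ?thesis using e by (simp add: r_def h_def)
  qed
  have round: "(\<lambda>Q. h Q * of_int \<lceil>x / h Q\<rceil>) \<longlonglongrightarrow> x" for x
  proof (rule tendsto_sandwich)
    show "\<forall>\<^sub>F Q in sequentially. x \<le> h Q * of_int \<lceil>x / h Q\<rceil>"
    proof (rule always_eventually, rule allI)
      fix Q
      have "h Q * (x / h Q) \<le> h Q * of_int \<lceil>x / h Q\<rceil>"
        using h[of Q] by (intro mult_left_mono) auto
      then show "x \<le> h Q * of_int \<lceil>x / h Q\<rceil>" using h[of Q] by simp
    qed
    show "\<forall>\<^sub>F Q in sequentially. h Q * of_int \<lceil>x / h Q\<rceil> \<le> x + h Q"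
    proof (rule always_eventually, rule allI)
      fix Q
      have "of_int \<lceil>x / h Q\<rceil> \<le> x / h Q + 1" by linarith
      then have "h Q * of_int \<lceil>x / h Q\<rceil> \<le> h Q * (x / h Q + 1)"
        using h[of Q] by (intro mult_left_mono) auto
      then show "h Q * of_int \<lceil>x / h Q\<rceil> \<le> x + h Q" using h[of Q] by (simp add: distrib_left)
    qed
    show "(\<lambda>Q. x + h Q) \<longlonglongrightarrow> x" using tendsto_add[OF tendsto_const h0, of x] by simp
  qed simp
  have "(\<lambda>Q. integral\<^sup>L lborel (G Q)) \<longlonglongrightarrow> integral\<^sup>L lborel (indicator S)"
  proof (rule integral_dominated_convergence[where w = "indicator ({0<..1} \<times> {0<..1})"])
    show "indicator S \<in> borel_measurable lborel" using S(1) by simp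
    show "G Q \<in> borel_measurable lborel" for Q
      using int[of Q] by (auto simp: has_bochner_integral_iff)
    show "integrable lborel (indicator ({0<..1} \<times> {0<..1}) :: real \<times> real \<Rightarrow> real)"
      using sq by (auto simp: has_bochner_integral_iff)
    show "AE p in lborel. norm (G Q p) \<le> indicator ({0<..1} \<times> {0<..1}) p" for Q
      using r1[of Q] by (intro always_eventually) (auto simp: G_def indicator_def)
    show "AE p in lborel. (\<lambda>Q. G Q p) \<longlonglongrightarrow> indicator S p"
      using conv[unfolded converges_ae_def] AE_coord_ne[of 0 0] AE_coord_ne[of 1 1]
    proof eventually_elim
      case (elim p)
      define u where "u = (\<lambda>Q. (h (Q - 1) * of_int \<lceil>fst p / h (Q - 1)\<rceil>,
                                   h (Q - 1) * of_int \<lceil>snd p / h (Q - 1)\<rceil>))"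
      have "(\<lambda>Q. u (Suc Q)) \<longlonglongrightarrow> (fst p, snd p)"
        unfolding u_def by (intro tendsto_Pair) (simp_all add: round)
      then have "u \<longlonglongrightarrow> p" by (simp add: LIMSEQ_imp_Suc)
      with elim have "\<forall>\<^sub>F Q in sequentially. u Q \<in> S' Q \<longleftrightarrow> p \<in> S" by blast
      then have ev: "\<forall>\<^sub>F Q in sequentially. u (Suc Q) \<in> S' (Suc Q) \<longleftrightarrow> p \<in> S"
        by (subst eventually_sequentially_Suc)
      \<comment> \<open>The domain \<open>(0, r Q]\<^sup>2\<close> of the step function may differ from the unit square near its boundary only.\<close>
      consider "p \<in> {0<..<1} \<times> {0<..<1}" | "p \<notin> {0..1} \<times> {0..1}"
        using elim by (cases p) force
      then show ?case
      proof cases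
        case 1
        then have "\<forall>\<^sub>F Q in sequentially. fst p < r Q" "\<forall>\<^sub>F Q in sequentially. snd p < r Q"
          by (auto intro!: order_tendstoD[OF rlim])
        with ev have "\<forall>\<^sub>F Q in sequentially. G Q p = indicator S p"
          by eventually_elim (use 1 in \<open>auto simp: G_def u_def indicator_def\<close>)
        then show ?thesis by (rule tendsto_eventually)
      next
        case 2
        then have "G Q p = 0" for Q using r1[of Q] by (auto simp: G_def indicator_def)
        moreover have "p \<notin> S" using 2 S by auto
        ultimately show ?thesis by simp
      qed
    qed
  qed
  also have "(\<lambda>Q. integral\<^sup>L lborel (G Q)) = (\<lambda>Q. (real e)\<^sup>2 * (s (Suc Q) / (real (Suc Q))\<^sup>2))"
    using int hs by (auto simp: has_bochner_integral_iff)
  also have "integral\<^sup>L lborel (indicator S) = measure lborel S" using S(1) by simp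
  finally have "(\<lambda>Q. (real e)\<^sup>2 * (s (Suc Q) / (real (Suc Q))\<^sup>2) / (real e)\<^sup>2) \<longlonglongrightarrow> measure lborel S / (real e)\<^sup>2"
    by (rule tendsto_divide[OF _ tendsto_const]) (use e in simp)
  then have "(\<lambda>Q. s (Suc Q) / (real (Suc Q))\<^sup>2) \<longlonglongrightarrow> measure lborel S / (real e)\<^sup>2"
    using e by simp
  then show "(\<lambda>Q. s Q / (real Q)\<^sup>2) \<longlonglongrightarrow> measure lborel S / (real e)\<^sup>2"
    by (rule LIMSEQ_imp_Suc)
  have "0 \<le> s Q" unfolding s_def by (rule sum_nonneg) auto
  moreover have "s Q \<le> real ((Q div e)\<^sup>2)"
    unfolding s_def by (rule order_trans[OF sum_bounded_above[where K = 1]])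
      (auto simp: indicator_def power2_eq_square)
  ultimately show "\<bar>s Q / (real Q)\<^sup>2\<bar> \<le> inverse ((real e)\<^sup>2)"
    using div_square_bound[OF e, of "s Q" Q] by simp
qed

lemma visible_count_moebius:
  "real (visible_count Q S) = (\<Sum>e\<in>{1..Q}. moebius_mu e * (\<Sum>(m,n)\<in>{1..Q div e} \<times> {1..Q div e}.
      indicator S (real (e * m) / real Q, real (e * n) / real Q)))"
proof -
  let ?V = "{(m,n). m \<in> {1..Q} \<and> n \<in> {1..Q} \<and> coprime m n}"
  have "finite ?V" by (rule finite_subset[of _ "{1..Q} \<times> {1..Q}"]) auto
  then have "real (visible_count Q S) = (\<Sum>z\<in>?V. indicator S (real (fst z) / real Q, real (snd z) / real Q))"
    unfolding visible_count_def card_eq_sum of_nat_sum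
    by (intro sum.mono_neutral_cong_left) (auto simp: indicator_def)
  then show ?thesis
    using sum_coprime_moebius[of "\<lambda>m n. indicator S (real m / real Q, real n / real Q)" Q]
    by (simp add: case_prod_unfold)
qed

lemma summable_inverse_squares: "summable (\<lambda>k. inverse ((real k)\<^sup>2))"
  using inverse_power_summable[of 2, where 'a = real] by simp

text \<open>
  Moebius inversion followed by Tannery's theorem, with the majorant \<open>1/e\<^sup>2\<close>.
\<close>

lemma LIMSEQ_visible_count_suminf:
  fixes S' :: "nat \<Rightarrow> (real \<times> real) set"
  assumes S: "S \<in> sets borel" "S \<subseteq> {0..1} \<times> {0..1}" and conv: "converges_ae S' S"
  shows "(\<lambda>Q. real (visible_count Q (S' Q)) / (real Q)\<^sup>2) \<longlonglongrightarrow>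
           (\<Sum>e. moebius_mu e / (real e)\<^sup>2) * measure lborel S"
proof -
  define s where "s = (\<lambda>e Q. \<Sum>(m,n)\<in>{1..Q div e} \<times> {1..Q div e}.
                  indicator (S' Q) (real (e * m) / real Q, real (e * n) / real Q) :: real)"
  define a where "a = (\<lambda>e Q. if e \<in> {1..Q} then moebius_mu e * (s e Q / (real Q)\<^sup>2) else 0)"
  have lim: "(\<lambda>Q. a e Q) \<longlonglongrightarrow> moebius_mu e / (real e)\<^sup>2 * measure lborel S" for e
  proof (cases "e = 0")
    case False
    have "(\<lambda>Q. moebius_mu e * (s e Q / (real Q)\<^sup>2)) \<longlonglongrightarrow> moebius_mu e * (measure lborel S / (real e)\<^sup>2)"
      unfolding s_def using False by (intro tendsto_intros LIMSEQ_rescaled_lattice_sum[OF S conv]) auto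
    moreover have "\<forall>\<^sub>F Q in sequentially. moebius_mu e * (s e Q / (real Q)\<^sup>2) = a e Q"
      using eventually_ge_at_top[of e] by eventually_elim (use False in \<open>auto simp: a_def\<close>)
    ultimately show ?thesis by (auto dest: Lim_transform_eventually)
  qed (simp add: a_def)
  have bound: "norm (a e Q) \<le> inverse ((real e)\<^sup>2)" for e Q
  proof (cases "e \<in> {1..Q}")
    case True
    have "norm (a e Q) = \<bar>moebius_mu e\<bar> * \<bar>s e Q / (real Q)\<^sup>2\<bar>"
      unfolding a_def if_P[OF True] real_norm_def abs_mult ..
    also have "\<dots> \<le> 1 * inverse ((real e)\<^sup>2)"
      unfolding s_def using True
      by (intro mult_mono abs_moebius_le LIMSEQ_rescaled_lattice_sum(2)[OF S conv]) auto
    finally show ?thesis by simp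
  qed (auto simp: a_def)
  have t: "summable (\<lambda>e. norm (moebius_mu e / (real e)\<^sup>2 * measure lborel S)) \<and>
        (\<lambda>Q. \<Sum>e. a e Q) \<longlonglongrightarrow> (\<Sum>e. moebius_mu e / (real e)\<^sup>2 * measure lborel S)"
    using tannerys_theorem[OF lim _ summable_inverse_squares] always_eventually[of "\<lambda>(e, Q). norm (a e Q) \<le> inverse ((real e)\<^sup>2)"] bound
    by simp
  have "summable (\<lambda>e. moebius_mu e / (real e)\<^sup>2)"
    by (rule summable_comparison_test'[OF summable_inverse_squares, of 0])
       (use abs_moebius_le in \<open>auto simp: divide_simps\<close>)
  then have "(\<Sum>e. moebius_mu e / (real e)\<^sup>2 * measure lborel S) = (\<Sum>e. moebius_mu e / (real e)\<^sup>2) * measure lborel S"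
    by (rule suminf_mult2[symmetric])
  moreover have "(\<Sum>e. a e Q) = real (visible_count Q (S' Q)) / (real Q)\<^sup>2" for Q
  proof -
    have "(\<Sum>e. a e Q) = (\<Sum>e\<in>{1..Q}. a e Q)"
      by (rule suminf_finite) (auto simp: a_def)
    also have "\<dots> = (\<Sum>e\<in>{1..Q}. moebius_mu e * s e Q) / (real Q)\<^sup>2"
      by (simp add: a_def sum_divide_distrib)
    finally show ?thesis by (simp add: visible_count_moebius s_def)
  qed
  ultimately show ?thesis using t by simp
qed

lemma partition_square_by_gcd:
  "Q\<^sup>2 = (\<Sum>e\<in>{1..Q}. visible_count (Q div e) UNIV)"
proof -
  define V where "V = (\<lambda>K. {(m, n). m \<in> {1..K} \<and> n \<in> {1..K} \<and> coprime m n} :: (nat \<times> nat) set)"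
  have finV: "finite (V K)" for K
    by (rule finite_subset[of _ "{1..K} \<times> {1..K}"]) (auto simp: V_def)
  have "Q\<^sup>2 = card ({1..Q} \<times> {1..Q})" by (simp add: power2_eq_square)
  also have "\<dots> = card (SIGMA e:{1..Q}. V (Q div e))"
  proof (rule sym, rule bij_betw_same_card, rule bij_betw_byWitness[where
        f = "\<lambda>(e, m, n). (e * m, e * n)" and f' = "\<lambda>(m, n). (gcd m n, m div gcd m n, n div gcd m n)"])
    show "\<forall>a\<in>SIGMA e:{1..Q}. V (Q div e). (\<lambda>(m, n). (gcd m n, m div gcd m n, n div gcd m n))
        ((\<lambda>(e, m, n). (e * m, e * n)) a) = a"
      by (auto simp: V_def gcd_mult_distrib_nat[symmetric] coprime_iff_gcd_eq_1)
    show "(\<lambda>(e, m, n). (e * m, e * n)) ` (SIGMA e:{1..Q}. V (Q div e)) \<subseteq> {1..Q} \<times> {1..Q}"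
      by (auto simp: V_def less_eq_div_iff_mult_less_eq mult.commute intro!: Nat.gr0I)
    have "gcd m n \<in> {1..Q} \<and> (m div gcd m n, n div gcd m n) \<in> V (Q div gcd m n)"
      if "m \<in> {1..Q}" "n \<in> {1..Q}" for m n
    proof -
      have g: "gcd m n > 0" "gcd m n \<le> m" "gcd m n \<le> n"
        using that by (auto intro: gcd_le1_nat gcd_le2_nat)
      then have "m div gcd m n > 0" "n div gcd m n > 0" by (auto simp: div_greater_zero_iff)
      moreover have "coprime (m div gcd m n) (n div gcd m n)"
        using that by (intro div_gcd_coprime) auto
      moreover have "m div gcd m n \<le> Q div gcd m n" "n div gcd m n \<le> Q div gcd m n"
        using that by (auto intro: div_le_mono)
      moreover have "gcd m n \<le> Q" using order_trans[OF g(2)] that by simp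
      ultimately show ?thesis using g(1) by (simp add: V_def Suc_le_eq)
    qed
    then show "(\<lambda>(m, n). (gcd m n, m div gcd m n, n div gcd m n)) ` ({1..Q} \<times> {1..Q})
        \<subseteq> (SIGMA e:{1..Q}. V (Q div e))" by fast
  qed auto
  also have "\<dots> = (\<Sum>e\<in>{1..Q}. card (V (Q div e)))" by (rule card_SigmaI) (use finV in auto)
  finally show ?thesis by (simp add: V_def visible_count_def)
qed

lemma LIMSEQ_visible_count_UNIV_suminf:
  "(\<lambda>Q. real (visible_count Q UNIV) / (real Q)\<^sup>2) \<longlonglongrightarrow> (\<Sum>e. moebius_mu e / (real e)\<^sup>2)"
proof -
  let ?k = "\<Sum>e. moebius_mu e / (real e)\<^sup>2" and ?v = "\<lambda>Q. real (visible_count Q UNIV)"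
  have "?v Q = real (visible_count Q ({0..1} \<times> {0..1}))" for Q
    unfolding visible_count_def
    by (intro arg_cong[of _ _ "\<lambda>A. real (card A)"]) (auto simp: divide_simps)
  moreover have "converges_ae (\<lambda>_. {0..1} \<times> {0..1}) ({0..1} \<times> {0..1})"
    unfolding converges_ae_def using AE_coord_ne[of 0 0] AE_coord_ne[of 1 1]
  proof eventually_elim
    case (elim p)
    then consider "p \<in> {0<..<1} \<times> {0<..<1}" | "p \<in> - ({0..1} \<times> {0..1})"
      by (cases p) force
    then show ?case
    proof cases
      case 1
      have o: "open ({0<..<1} \<times> {0<..<1} :: (real \<times> real) set)" by (intro open_Times) auto
      show ?thesis using 1
        by (auto dest!: topological_tendstoD[OF _ o] elim!: eventually_mono)
    next
      case 2
      have o: "open (- ({0..1} \<times> {0..1} :: (real \<times> real) set))" by (intro open_Compl closed_Times) auto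
      show ?thesis using 2
        by (auto dest!: topological_tendstoD[OF _ o] elim!: eventually_mono)
    qed
  qed
  moreover have "measure lborel ({0..1} \<times> {0..1} :: (real \<times> real) set) = 1"
    unfolding measure_def lborel_prod[symmetric]
    by (subst lborel.emeasure_pair_measure_Times) auto
  moreover have "{0..1} \<times> {0..1} \<in> sets (borel :: (real \<times> real) measure)"
    by (intro borel_closed closed_Times) auto
  ultimately show ?thesis
    using LIMSEQ_visible_count_suminf[of "{0..1} \<times> {0..1}" "\<lambda>_. {0..1} \<times> {0..1}"] by simp
qed

text \<open>
  The constant is read off from a count that is known exactly: the \<open>Q\<^sup>2\<close> points of a square are
  partitioned by their greatest common divisor, so the limit of the coprime density times the sum of the inverse squares is 1.
\<close>

lemma suminf_moebius: "(\<Sum>e. moebius_mu e / (real e)\<^sup>2) = 6 / pi\<^sup>2"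
proof -
  let ?k = "\<Sum>e. moebius_mu e / (real e)\<^sup>2" and ?v = "\<lambda>Q. real (visible_count Q UNIV)"
  note vlim = LIMSEQ_visible_count_UNIV_suminf
  define b where "b = (\<lambda>e Q. if e \<in> {1..Q} then ?v (Q div e) / (real Q)\<^sup>2 else 0)"
  have lim: "(\<lambda>Q. b e Q) \<longlonglongrightarrow> ?k * inverse ((real e)\<^sup>2)" for e
  proof (cases "e = 0")
    case False
    have "filterlim (\<lambda>Q. Q div e) sequentially sequentially"
      using False by (intro filterlim_at_top_div_const_nat) auto
    then have "(\<lambda>Q. ?v (Q div e) / (real (Q div e))\<^sup>2 * (real (Q div e) / real Q)\<^sup>2) \<longlonglongrightarrow> ?k * (1 / real e)\<^sup>2"
      using False by (intro tendsto_mult tendsto_power filterlim_compose[OF vlim] LIMSEQ_nat_div) auto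
    moreover have "\<forall>\<^sub>F Q in sequentially.
        ?v (Q div e) / (real (Q div e))\<^sup>2 * (real (Q div e) / real Q)\<^sup>2 = b e Q"
      using eventually_ge_at_top[of e]
      by eventually_elim (use False in \<open>auto simp: b_def power_divide div_greater_zero_iff\<close>)
    ultimately show ?thesis by (auto dest: Lim_transform_eventually simp: power_divide inverse_eq_divide)
  qed (simp add: b_def)
  have bound: "norm (b e Q) \<le> inverse ((real e)\<^sup>2)" for e Q
  proof (cases "e \<in> {1..Q}")
    case True
    have "visible_count (Q div e) UNIV \<le> card ({1..Q div e} \<times> {1..Q div e})"
      unfolding visible_count_def by (intro card_mono) auto
    then have "?v (Q div e) \<le> real ((Q div e)\<^sup>2)" by (simp add: power2_eq_square del: of_nat_mult)
    then show ?thesis using True div_square_bound[of e "?v (Q div e)" Q] by (simp add: b_def)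
  qed (auto simp: b_def)
  have "(\<lambda>Q. \<Sum>e. b e Q) \<longlonglongrightarrow> (\<Sum>e. ?k * inverse ((real e)\<^sup>2))"
    using tannerys_theorem[OF lim _ summable_inverse_squares] always_eventually[of "\<lambda>(e, Q). norm (b e Q) \<le> inverse ((real e)\<^sup>2)"] bound
    by simp
  moreover have "\<forall>\<^sub>F Q in sequentially. (\<Sum>e. b e Q) = 1"
    using eventually_gt_at_top[of 0]
  proof eventually_elim
    case (elim Q)
    have "(\<Sum>e. b e Q) = (\<Sum>e\<in>{1..Q}. b e Q)"
      by (rule suminf_finite) (auto simp: b_def)
    also have "\<dots> = (\<Sum>e\<in>{1..Q}. ?v (Q div e)) / (real Q)\<^sup>2"
      by (simp add: b_def sum_divide_distrib)
    also have "(\<Sum>e\<in>{1..Q}. ?v (Q div e)) = (real Q)\<^sup>2"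
      by (metis partition_square_by_gcd of_nat_power of_nat_sum)
    finally show ?case using elim by simp
  qed
  ultimately have "(\<lambda>Q. 1 :: real) \<longlonglongrightarrow> (\<Sum>e. ?k * inverse ((real e)\<^sup>2))"
    by (rule Lim_transform_eventually)
  then have "(\<Sum>e. ?k * inverse ((real e)\<^sup>2)) = 1"
    by (simp add: LIMSEQ_const_iff)
  then have "?k * (\<Sum>e. inverse ((real e)\<^sup>2)) = 1"
    using suminf_mult[OF summable_inverse_squares] by simp
  also have "(\<Sum>e. inverse ((real e)\<^sup>2)) = pi\<^sup>2 / 6"
    using suminf_split_head[OF summable_inverse_squares] sums_unique[OF inverse_squares_sums]
    by (simp add: inverse_eq_divide add.commute)
  finally show ?thesis by (simp add: field_simps)
qed

lemma LIMSEQ_visible_count: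
  fixes S' :: "nat \<Rightarrow> (real \<times> real) set"
  assumes "S \<in> sets borel" "S \<subseteq> {0..1} \<times> {0..1}" "converges_ae S' S"
  shows "(\<lambda>Q. real (visible_count Q (S' Q)) / (real Q)\<^sup>2) \<longlonglongrightarrow> 6 / pi\<^sup>2 * measure lborel S"
  using LIMSEQ_visible_count_suminf[OF assms] by (simp add: suminf_moebius)

lemma LIMSEQ_visible_count_UNIV:
  "(\<lambda>Q. real (visible_count Q UNIV) / (real Q)\<^sup>2) \<longlonglongrightarrow> 6 / pi\<^sup>2"
  using LIMSEQ_visible_count_UNIV_suminf by (simp add: suminf_moebius)

section \<open>The number of Farey fractions\<close>

text \<open>
  Cancelling the common divisor of \<open>u\<close> and \<open>q\<close> only decreases the denominator.
\<close>

lemma farey_memI: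
  fixes u q :: int
  assumes "t = of_int u / of_int q" "0 < q" "q \<le> int Q" "t \<in> {0<..1}"
  shows "t \<in> farey Q"
proof -
  define g where "g = gcd u q"
  have g: "g > 0" "g dvd u" "g dvd q" using assms(2) by (auto simp: g_def)
  have u: "u > 0" "u \<le> q" using assms by (auto simp: zero_less_divide_iff)
  define a b where "a = nat (u div g)" and "b = nat (q div g)"
  have ug: "u div g > 0" "q div g > 0" "u div g \<le> q div g"
    using g u assms(2) by (auto simp: pos_imp_zdiv_pos_iff zdvd_imp_le intro: zdiv_mono1)
  have "t = real a / real b"
  proof -
    have "u = g * (u div g)" "q = g * (q div g)" using g by auto
    then have "t = (of_int g * of_int (u div g)) / (of_int g * of_int (q div g))"
      using assms(1) by (metis of_int_mult)
    also have "\<dots> = of_int (u div g) / of_int (q div g)" using g by simp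
    finally show ?thesis using ug by (simp add: a_def b_def)
  qed
  moreover have "1 \<le> a" "a \<le> b" using ug by (auto simp: a_def b_def)
  moreover have "b \<le> Q"
  proof -
    have "q div g \<le> q" using zdiv_mono2[of q 1 g] g(1) assms(2) by simp
    then show ?thesis using assms(3) by (simp add: b_def)
  qed
  moreover have "coprime a b"
  proof -
    have "coprime (u div g) (q div g)" unfolding g_def using assms(2) by (intro div_gcd_coprime) auto
    moreover have "u div g = int a" "q div g = int b" using ug by (auto simp: a_def b_def)
    ultimately show ?thesis by simp
  qed
  ultimately show ?thesis unfolding farey_def by blast
qed

lemma farey_subset: "farey Q \<subseteq> {0<..1}"
  by (auto simp: farey_def)

lemma reduced_fraction_unique:
  assumes "real a / real q = real a' / real q'" "coprime a q" "coprime a' q'" "q > 0" "q' > 0"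
  shows "a = a' \<and> q = q'"
proof -
  have "real (a * q') = real (a' * q)" using assms by (simp add: field_simps)
  then have eq: "a * q' = a' * q" by (simp only: of_nat_eq_iff)
  have "q dvd q'" "q' dvd q"
    using eq assms(2,3) by (metis coprime_commute coprime_dvd_mult_right_iff dvd_triv_right)+
  then have "q = q'" by (rule dvd_antisym)
  then show ?thesis using eq assms by auto
qed

definition farey_pairs :: "nat \<Rightarrow> (nat \<times> nat) set" where
  "farey_pairs Q = {(a, q). 1 \<le> a \<and> a \<le> q \<and> q \<le> Q \<and> coprime a q}"

lemma bij_betw_farey: "bij_betw (\<lambda>(a, q). real a / real q) (farey_pairs Q) (farey Q)"
  unfolding bij_betw_def
proof
  show "inj_on (\<lambda>(a, q). real a / real q) (farey_pairs Q)"
    by (rule inj_onI) (auto simp: farey_pairs_def dest!: reduced_fraction_unique)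
  show "(\<lambda>(a, q). real a / real q) ` farey_pairs Q = farey Q"
    by (auto simp: farey_pairs_def farey_def)
qed

lemma finite_farey_pairs: "finite (farey_pairs Q)"
  by (rule finite_subset[of _ "{1..Q} \<times> {1..Q}"]) (auto simp: farey_pairs_def)

lemma finite_farey: "finite (farey Q)"
  using bij_betw_finite[OF bij_betw_farey] finite_farey_pairs by blast

lemma incseq_farey: "incseq farey"
  unfolding incseq_def farey_def by fastforce

text \<open>
  The coprime pairs of the square split along the diagonal into two copies of the Farey pairs, which meet in \<open>(1, 1)\<close> only.
\<close>

lemma twice_card_farey:
  assumes "Q \<ge> 1"
  shows "2 * card (farey Q) = visible_count Q UNIV + 1"
proof -
  let ?A = "farey_pairs Q" and ?B = "prod.swap ` farey_pairs Q"
  have "?A \<union> ?B = {(m, n). m \<in> {1..Q} \<and> n \<in> {1..Q} \<and> coprime m n}"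
    by (force simp: farey_pairs_def coprime_commute image_iff)
  moreover have "?A \<inter> ?B = {(1, 1)}"
    using assms by (auto simp: farey_pairs_def image_iff)
  moreover have "card ?B = card ?A" by (intro card_image) simp
  moreover have "card ?A = card (farey Q)" by (rule bij_betw_same_card[OF bij_betw_farey])
  ultimately show ?thesis
    using card_Un_Int[of ?A ?B] finite_farey_pairs by (simp add: visible_count_def)
qed

lemma LIMSEQ_card_farey: "(\<lambda>Q. real (card (farey Q)) / (real Q)\<^sup>2) \<longlonglongrightarrow> 3 / pi\<^sup>2"
proof -
  have "(\<lambda>Q. (real (visible_count Q UNIV) / (real Q)\<^sup>2 + (1 / real Q)\<^sup>2) / 2) \<longlonglongrightarrow> (6 / pi\<^sup>2 + 0\<^sup>2) / 2"
    by (intro tendsto_intros LIMSEQ_visible_count_UNIV lim_1_over_n) simp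
  moreover have "\<forall>\<^sub>F Q in sequentially. (real (visible_count Q UNIV) / (real Q)\<^sup>2 + (1 / real Q)\<^sup>2) / 2
      = real (card (farey Q)) / (real Q)\<^sup>2"
    using eventually_ge_at_top[of 1]
  proof eventually_elim
    case (elim Q)
    have "real (visible_count Q UNIV) = 2 * real (card (farey Q)) - 1"
      using twice_card_farey[OF elim] by linarith
    then show ?case by (simp add: power_divide diff_divide_distrib)
  qed
  ultimately have "(\<lambda>Q. real (card (farey Q)) / (real Q)\<^sup>2) \<longlonglongrightarrow> (6 / pi\<^sup>2 + 0\<^sup>2) / 2"
    by (rule Lim_transform_eventually)
  then show ?thesis by simp
qed

section \<open>Primitive index tuples and their regions\<close>

text \<open>
  A function \<open>p\<close> assigns to every position \<open>j\<close> of the tuple the index pair \<open>(A\<^sub>j, B\<^sub>j)\<close>. At \<open>(m, n)\<close> this is the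
  denominator of the \<open>j\<close>-th fraction, and \<open>gap\<close> is that fraction minus the last one.
\<close>

definition den :: "(nat \<Rightarrow> int \<times> int) \<Rightarrow> nat \<Rightarrow> real \<times> real \<Rightarrow> real" where
  "den p j z = of_int (fst (p j)) * snd z - of_int (snd (p j)) * fst z"

definition gap :: "(nat \<Rightarrow> int \<times> int) \<Rightarrow> nat \<Rightarrow> real \<times> real \<Rightarrow> real" where
  "gap p j z = of_int (snd (p j)) / (snd z * den p j z)"

text \<open>
  The factor \<open>c\<close> is the number of fractions divided by \<open>Q\<^sup>2\<close>, or its limit \<open>3/\<pi>\<^sup>2\<close>.
  For tuples with \<open>p \<nu> = (1, 0)\<close> the condition on \<open>den p \<nu>\<close> is \<open>0 < y \<le> 1\<close>.
\<close>

definition region :: "nat \<Rightarrow> (nat \<Rightarrow> real set) \<Rightarrow> real \<Rightarrow> (nat \<Rightarrow> int \<times> int) \<Rightarrow> (real \<times> real) set" where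
  "region \<nu> I c p = {z. fst z \<in> {0..} \<and> snd z - fst z \<in> {0..} \<and>
     (\<forall>j\<in>{1..\<nu>}. den p j z \<in> {0<..1}) \<and>
     (\<forall>j\<in>{1..\<nu> - 1}. c * (gap p j z - gap p (j + 1) z) \<in> I j)}"

definition primitive_tuples :: "nat \<Rightarrow> (nat \<Rightarrow> int \<times> int) set" where
  "primitive_tuples \<nu> = {p \<in> {1..\<nu>} \<rightarrow>\<^sub>E UNIV. inj_on p {1..\<nu>} \<and> p \<nu> = (1, 0) \<and>
     (\<forall>j\<in>{1..\<nu>}. coprime (fst (p j)) (snd (p j)))}"

lemma primitive_tuplesD:
  assumes "p \<in> primitive_tuples \<nu>"
  shows "p \<in> extensional {1..\<nu>}" "inj_on p {1..\<nu>}" "p \<nu> = (1, 0)"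
    "j \<in> {1..\<nu>} \<Longrightarrow> coprime (fst (p j)) (snd (p j))"
  using assms by (simp_all add: primitive_tuples_def PiE_def)

lemma gap_last: "p \<in> primitive_tuples \<nu> \<Longrightarrow> gap p \<nu> z = 0"
  using primitive_tuplesD(3)[of p \<nu>] by (simp add: gap_def)

lemma den_last: "p \<in> primitive_tuples \<nu> \<Longrightarrow> den p \<nu> z = snd z"
  using primitive_tuplesD(3)[of p \<nu>] by (simp add: den_def)

text \<open>
  Two parallel primitive vectors agree up to sign, and the positivity of the linear form fixes the sign.
\<close>

lemma parallel_primitive:
  fixes a b a' b' :: int and x y :: real
  assumes "coprime a b" "coprime a' b'" "b * a' = b' * a"
    and pos: "of_int a * y - of_int b * x > 0" "of_int a' * y - of_int b' * x > 0"
  shows "a = a' \<and> b = b'"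
proof -
  obtain u w where uw: "u * a + w * b = 1"
    using assms(1) bezout_int[of a b] by (auto simp: coprime_iff_gcd_eq_1)
  define t where "t = u * a' + w * b'"
  have a': "a' = t * a" and b': "b' = t * b"
    using uw assms(3) unfolding t_def by algebra+
  have "is_unit t" using assms(2) by (rule coprime_common_divisor) (auto simp: a' b')
  moreover have "t > 0"
  proof -
    have "of_int t * (of_int a * y - of_int b * x) > 0"
      using pos(2) by (simp add: a' b' algebra_simps)
    then show ?thesis using pos(1) by (simp add: zero_less_mult_iff)
  qed
  ultimately have "t = 1" by auto
  then show ?thesis using a' b' by simp
qed

text \<open>
  The ordinate cancels, so the points where a difference of gaps takes a prescribed value lie on a conic.
\<close>

lemma gap_diff:
  assumes "snd z \<noteq> 0" "den p i z \<noteq> 0" "den p j z \<noteq> 0"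
  shows "gap p i z - gap p j z =
    of_int (snd (p i) * fst (p j) - snd (p j) * fst (p i)) / (den p i z * den p j z)"
proof -
  have "of_int (snd (p i)) * den p j z - of_int (snd (p j)) * den p i z =
        snd z * of_int (snd (p i) * fst (p j) - snd (p j) * fst (p i))"
    by (simp add: den_def algebra_simps)
  moreover have "gap p i z - gap p j z =
     (of_int (snd (p i)) * den p j z - of_int (snd (p j)) * den p i z) / (snd z * (den p i z * den p j z))"
    using assms by (simp add: gap_def field_simps)
  ultimately show ?thesis using assms(1) by simp
qed

lemma primitive_det_nonzero:
  assumes p: "p \<in> primitive_tuples \<nu>" and ij: "i \<in> {1..\<nu>}" "j \<in> {1..\<nu>}" "i \<noteq> j"
    and pos: "den p i z > 0" "den p j z > 0"
  shows "snd (p i) * fst (p j) - snd (p j) * fst (p i) \<noteq> 0"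
proof
  assume "snd (p i) * fst (p j) - snd (p j) * fst (p i) = 0"
  then have "fst (p i) = fst (p j) \<and> snd (p i) = snd (p j)"
    using p ij pos by (intro parallel_primitive[where x = "fst z" and y = "snd z"])
      (auto simp: primitive_tuples_def den_def)
  then have "p i = p j" by (simp add: prod_eq_iff)
  moreover have "inj_on p {1..\<nu>}" using p by (simp add: primitive_tuples_def)
  ultimately show False using ij by (auto dest: inj_onD)
qed

section \<open>Stability of the regions\<close>

lemma bounded_interval_sandwich:
  fixes I :: "real set"
  assumes "is_interval I" "bounded I"
  obtains a b where "{a<..<b} \<subseteq> I" "I \<subseteq> {a..b}"
proof (cases "I = {}")
  case True
  then show ?thesis using that[of 0 0] by auto
next
  case False
  have bd: "bdd_above I" "bdd_below I"
    using assms(2) by (auto intro: bounded_imp_bdd_above bounded_imp_bdd_below)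
  show ?thesis
  proof (rule that[of "Inf I" "Sup I"])
    show "I \<subseteq> {Inf I..Sup I}" using bd by (auto intro: cInf_lower cSup_upper)
    show "{Inf I<..<Sup I} \<subseteq> I"
    proof
      fix t assume "t \<in> {Inf I<..<Sup I}"
      then obtain u v where "u \<in> I" "u < t" "v \<in> I" "t < v"
        using False bd by (auto simp: cInf_less_iff less_cSup_iff)
      then show "t \<in> I" using assms(1) unfolding is_interval_1 by (meson less_imp_le)
    qed
  qed
qed

text \<open>
  Only the two endpoints can lie on the frontier; this keeps the exceptional set below a finite union.
\<close>

lemma frontier_bounded_interval:
  fixes I :: "real set"
  assumes "is_interval I" "bounded I"
  shows "finite (frontier I)"
proof -
  obtain a b where ab: "{a<..<b} \<subseteq> I" "I \<subseteq> {a..b}"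
    using bounded_interval_sandwich[OF assms] by blast
  have "closure I \<subseteq> {a..b}" using ab(2) by (rule closure_minimal) simp
  moreover have "{a<..<b} \<subseteq> interior I" using ab(1) by (rule interior_maximal) simp
  ultimately have "frontier I \<subseteq> {a, b}" 
    by (force simp: frontier_def)
  then show ?thesis by (rule finite_subset) simp
qed

lemma borel_bounded_interval:
  fixes I :: "real set"
  assumes "is_interval I" "bounded I"
  shows "I \<in> sets borel"
proof -
  obtain a b where ab: "{a<..<b} \<subseteq> I" "I \<subseteq> {a..b}"
    using bounded_interval_sandwich[OF assms] by blast
  have "I = {a<..<b} \<union> (I \<inter> {a, b})" using ab by force
  moreover have "I \<inter> {a, b} \<in> sets borel" by (intro borel_closed finite_imp_closed) auto
  ultimately show ?thesis by (metis borel_open open_greaterThanLessThan sets.Un)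
qed

lemma eventually_mem_iff_not_frontier:
  assumes "u \<longlonglongrightarrow> t" "t \<notin> frontier S"
  shows "\<forall>\<^sub>F Q in sequentially. u Q \<in> S \<longleftrightarrow> t \<in> S"
proof (cases "t \<in> S")
  case True
  then have "t \<in> interior S" using assms(2) closure_subset by (auto simp: frontier_def)
  from topological_tendstoD[OF assms(1) open_interior this] show ?thesis
    by eventually_elim (use True interior_subset in auto)
next
  case False
  then have "t \<in> - closure S" using assms(2) interior_subset by (auto simp: frontier_def)
  from topological_tendstoD[OF assms(1) _ this] have "\<forall>\<^sub>F Q in sequentially. u Q \<in> - closure S" by auto
  then show ?thesis by eventually_elim (use False closure_subset in auto)
qed

lemma AE_line_ne:
  fixes a b k :: real
  assumes "a \<noteq> 0 \<or> b \<noteq> 0"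
  shows "AE z in lborel. a * snd z - b * fst z \<noteq> k"
proof -
  have "AE z in lborel. a * snd z - b * fst z - k \<noteq> 0"
  proof (rule AE_lborel_slices[of "\<lambda>z. a * snd z - b * fst z - k" "if b = 0 then {k / a} else {}"])
    fix y assume y: "y \<notin> (if b = 0 then {k / a} else {})"
    show "finite {x. a * snd (x, y) - b * fst (x, y) - k = 0}"
    proof (cases "b = 0")
      case True
      then show ?thesis using y assms by (auto simp: field_simps)
    next
      case False
      then have "{x. a * snd (x, y) - b * fst (x, y) - k = 0} \<subseteq> {(a * y - k) / b}"
        by (auto simp: field_simps)
      then show ?thesis by (rule finite_subset) simp
    qed
  qed (auto intro!: continuous_intros)
  then show ?thesis by eventually_elim simp
qed

text \<open>
  On a horizontal line the equation is a polynomial in \<open>x\<close>. It is not the zero polynomial, because one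
  of the two linear factors has a root and the constant \<open>k\<close> does not vanish.
\<close>

lemma AE_conic_ne:
  fixes a1 b1 a2 b2 k e :: real
  assumes "k \<noteq> 0" "b1 \<noteq> 0 \<or> b2 \<noteq> 0"
  shows "AE z in lborel. e * ((a1 * snd z - b1 * fst z) * (a2 * snd z - b2 * fst z)) \<noteq> k"
proof -
  have "AE z in lborel. e * ((a1 * snd z - b1 * fst z) * (a2 * snd z - b2 * fst z)) - k \<noteq> 0"
  proof (rule AE_lborel_slices[of "\<lambda>z. e * ((a1 * snd z - b1 * fst z) * (a2 * snd z - b2 * fst z)) - k" "{}"])
    fix y :: real
    let ?P = "smult e ([:a1 * y, - b1:] * [:a2 * y, - b2:]) - [:k:]"
    have eq: "poly ?P x = e * ((a1 * y - b1 * x) * (a2 * y - b2 * x)) - k" for x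
      by (simp add: algebra_simps)
    have "\<exists>x. (a1 * y - b1 * x) * (a2 * y - b2 * x) = 0"
      using assms(2)
    proof
      assume "b1 \<noteq> 0"
      then show ?thesis by (intro exI[of _ "a1 * y / b1"]) simp
    next
      assume "b2 \<noteq> 0"
      then show ?thesis by (intro exI[of _ "a2 * y / b2"]) simp
    qed
    then obtain x where "poly ?P x = - k" unfolding eq by auto
    then have "?P \<noteq> 0" using assms(1) by (metis neg_equal_0_iff_equal poly_0)
    then have "finite {x. poly ?P x = 0}" by (rule poly_roots_finite)
    then show "finite {x. e * ((a1 * snd (x, y) - b1 * fst (x, y)) * (a2 * snd (x, y) - b2 * fst (x, y))) - k = 0}"
      unfolding eq by simp
  qed (auto intro!: continuous_intros)
  then show ?thesis by eventually_elim simp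
qed

lemma measurable_region:
  assumes "\<And>j. j \<in> {1..\<nu> - 1} \<Longrightarrow> I j \<in> sets borel"
  shows "region \<nu> I c p \<in> sets borel"
proof -
  have d: "den p j \<in> borel_measurable (borel \<Otimes>\<^sub>M borel)" for j
    unfolding den_def by measurable
  then have g: "gap p j \<in> borel_measurable (borel \<Otimes>\<^sub>M borel)" for j
    unfolding gap_def by measurable
  have "{z \<in> space (borel \<Otimes>\<^sub>M borel). c * (gap p j z - gap p (j + 1) z) \<in> I j} \<in> sets (borel \<Otimes>\<^sub>M borel)"
    if "j \<in> {1..\<nu> - 1}" for j
  proof -
    have [measurable]: "I j \<in> sets borel" using assms that by blast
    note [measurable] = g
    show ?thesis by measurable
  qed
  then have "{z \<in> space (borel \<Otimes>\<^sub>M borel). \<forall>j\<in>{1..\<nu> - 1}. c * (gap p j z - gap p (j + 1) z) \<in> I j} \<in> sets (borel \<Otimes>\<^sub>M borel)"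
    by (intro sets.sets_Collect_finite_All) auto
  moreover note d [measurable]
  have "{z \<in> space (borel \<Otimes>\<^sub>M borel). fst z \<in> {0..} \<and> snd z - fst z \<in> {0..} \<and>
     (\<forall>j\<in>{1..\<nu>}. den p j z \<in> {0<..1})} \<in> sets (borel \<Otimes>\<^sub>M borel)"
    by measurable
  ultimately have "{z \<in> space (borel \<Otimes>\<^sub>M borel). fst z \<in> {0..} \<and> snd z - fst z \<in> {0..} \<and>
     (\<forall>j\<in>{1..\<nu>}. den p j z \<in> {0<..1})} \<inter>
     {z \<in> space (borel \<Otimes>\<^sub>M borel). \<forall>j\<in>{1..\<nu> - 1}. c * (gap p j z - gap p (j + 1) z) \<in> I j}
      \<in> sets (borel \<Otimes>\<^sub>M borel)" by (rule sets.Int[rotated])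
  then show ?thesis
    unfolding borel_prod
    by (rule back_subst[of "\<lambda>A. A \<in> sets borel"]) (auto simp: region_def)
qed

text \<open>
  Each defining condition says that a function continuous near \<open>z\<close> takes its value in an interval, and this is stable
  unless the value is an endpoint. Such exceptional points lie on finitely many lines and, by \<open>gap_diff\<close>, conics.
  The conics are proper because different indices are not parallel.
\<close>

lemma converges_ae_region:
  assumes p: "p \<in> primitive_tuples \<nu>"
    and I: "\<And>j. j \<in> {1..\<nu> - 1} \<Longrightarrow> is_interval (I j) \<and> bounded (I j)"
    and c: "c' \<longlonglongrightarrow> c" "c > 0"
  shows "converges_ae (\<lambda>Q. region \<nu> I (c' Q) p) (region \<nu> I c p)"
proof -
  have coord: "AE z in lborel. fst z \<noteq> (0::real) \<and> snd z \<noteq> (0::real)"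
    by (rule AE_coord_ne)
  have diag: "AE z in lborel. 1 * snd z - 1 * fst z \<noteq> (0::real)"
    by (rule AE_line_ne) simp
  have line: "AE z in lborel. \<forall>j\<in>{1..\<nu>}. \<forall>k\<in>{0, 1}. den p j z \<noteq> k"
  proof (intro AE_finite_allI)
    fix j k assume "j \<in> {1..\<nu>}"
    then have "coprime (fst (p j)) (snd (p j))" using p by (auto simp: primitive_tuples_def)
    then have "fst (p j) \<noteq> 0 \<or> snd (p j) \<noteq> 0" by auto
    then show "AE z in lborel. den p j z \<noteq> k"
      unfolding den_def by (intro AE_line_ne) auto
  qed auto
  have conic: "AE z in lborel. \<forall>j\<in>{1..\<nu> - 1}. \<forall>e\<in>frontier (I j).
      let k = c * of_int (snd (p j) * fst (p (j + 1)) - snd (p (j + 1)) * fst (p j)) in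
      k \<noteq> 0 \<longrightarrow> e * (den p j z * den p (j + 1) z) \<noteq> k"
  proof (intro AE_finite_allI)
    fix j e assume j: "j \<in> {1..\<nu> - 1}"
    let ?d = "snd (p j) * fst (p (j + 1)) - snd (p (j + 1)) * fst (p j)"
    show "AE z in lborel. let k = c * of_int ?d in k \<noteq> 0 \<longrightarrow> e * (den p j z * den p (j + 1) z) \<noteq> k"
    proof (cases "?d = 0")
      case False
      then have "snd (p j) \<noteq> 0 \<or> snd (p (j + 1)) \<noteq> 0" by auto
      then have "AE z in lborel. e * (den p j z * den p (j + 1) z) \<noteq> c * of_int ?d"
        unfolding den_def using False c by (intro AE_conic_ne) (auto simp del: of_int_diff of_int_mult)
      then show ?thesis by eventually_elim (simp add: Let_def)
    qed simp
  qed (use I frontier_bounded_interval in auto)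
  show ?thesis
    unfolding converges_ae_def using coord diag line conic
  proof eventually_elim
    case (elim z)
    show ?case
    proof (intro allI impI)
      fix u assume u: "u \<longlonglongrightarrow> z"
      have f: "(\<lambda>Q. fst (u Q)) \<longlonglongrightarrow> fst z" and s: "(\<lambda>Q. snd (u Q)) \<longlonglongrightarrow> snd z"
        using u by (auto intro: tendsto_fst tendsto_snd)
      have dl: "(\<lambda>Q. den p j (u Q)) \<longlonglongrightarrow> den p j z" for j
        unfolding den_def by (intro tendsto_intros f s)
      have gl: "(\<lambda>Q. gap p j (u Q)) \<longlonglongrightarrow> gap p j z" if "j \<in> {1..\<nu>}" for j
        unfolding gap_def using elim(1,3) that by (intro tendsto_intros s dl) auto
      have 1: "\<forall>\<^sub>F Q in sequentially. fst (u Q) \<in> {0..} \<longleftrightarrow> fst z \<in> {0..}"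
        by (rule eventually_mem_iff_not_frontier[OF f]) (use elim in simp)
      have 2: "\<forall>\<^sub>F Q in sequentially. snd (u Q) - fst (u Q) \<in> {0..} \<longleftrightarrow> snd z - fst z \<in> {0..}"
        by (rule eventually_mem_iff_not_frontier[OF tendsto_diff[OF s f]]) (use elim in simp)
      have 3: "\<forall>\<^sub>F Q in sequentially. \<forall>j\<in>{1..\<nu>}. den p j (u Q) \<in> {0<..1} \<longleftrightarrow> den p j z \<in> {0<..1}"
      proof (rule eventually_ball_finite, simp, rule ballI)
        fix j assume "j \<in> {1..\<nu>}"
        then have "den p j z \<notin> frontier {0<..1}" using elim(3) by (auto simp: frontier_def)
        then show "\<forall>\<^sub>F Q in sequentially. den p j (u Q) \<in> {0<..1} \<longleftrightarrow> den p j z \<in> {0<..1}"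
          by (rule eventually_mem_iff_not_frontier[OF dl])
      qed
      show "\<forall>\<^sub>F Q in sequentially. (u Q \<in> region \<nu> I (c' Q) p) = (z \<in> region \<nu> I c p)"
      proof (cases "\<forall>j\<in>{1..\<nu>}. den p j z \<in> {0<..1}")
        case False
        from 3 show ?thesis by eventually_elim (use False in \<open>auto simp: region_def\<close>)
      next
        case True
        have 4: "\<forall>\<^sub>F Q in sequentially. \<forall>j\<in>{1..\<nu> - 1}.
            c' Q * (gap p j (u Q) - gap p (j + 1) (u Q)) \<in> I j \<longleftrightarrow>
            c * (gap p j z - gap p (j + 1) z) \<in> I j"
        proof (rule eventually_ball_finite, simp, rule ballI)
          fix j assume j: "j \<in> {1..\<nu> - 1}"
          then have jj: "j \<in> {1..\<nu>}" "j + 1 \<in> {1..\<nu>}" by auto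
          then have pos: "den p j z > 0" "den p (j + 1) z > 0" using True by auto
          let ?d = "snd (p j) * fst (p (j + 1)) - snd (p (j + 1)) * fst (p j)"
          have d: "?d \<noteq> 0" using jj pos by (intro primitive_det_nonzero[OF p]) auto
          have "c * (gap p j z - gap p (j + 1) z) \<notin> frontier (I j)"
          proof
            assume e: "c * (gap p j z - gap p (j + 1) z) \<in> frontier (I j)"
            have "c * (gap p j z - gap p (j + 1) z) * (den p j z * den p (j + 1) z) = c * of_int ?d"
              using elim(1) pos by (subst gap_diff) auto
            then show False using bspec[OF bspec[OF elim(4) j] e] d c(2)
              by (simp add: Let_def del: of_int_diff of_int_mult)
          qed
          then show "\<forall>\<^sub>F Q in sequentially. c' Q * (gap p j (u Q) - gap p (j + 1) (u Q)) \<in> I j \<longleftrightarrow>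
            c * (gap p j z - gap p (j + 1) z) \<in> I j"
            by (rule eventually_mem_iff_not_frontier[rotated])
              (intro tendsto_intros c gl jj)
        qed
        from 1 2 3 4 show ?thesis by eventually_elim (auto simp: region_def)
      qed
    qed
  qed
qed

section \<open>Only finitely many index tuples matter\<close>

text \<open>
  The gap to the last entry, where it vanishes, is a sum of at most \<open>\<nu>\<close> consecutive differences.
\<close>

lemma gap_bound:
  assumes p: "p \<in> primitive_tuples \<nu>" and z: "z \<in> region \<nu> I c p"
    and M: "\<And>j t. j \<in> {1..\<nu> - 1} \<Longrightarrow> t \<in> I j \<Longrightarrow> \<bar>t\<bar> \<le> M" "M \<ge> 0" and j: "j \<in> {1..\<nu>}"
  shows "\<bar>c * gap p j z\<bar> \<le> real \<nu> * M"
proof -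
  have "j \<le> \<nu>" using j by simp
  then have "1 \<le> j \<longrightarrow> \<bar>c * gap p j z\<bar> \<le> real (\<nu> - j) * M"
  proof (induction rule: inc_induct)
    case base
    show ?case using gap_last[OF p] by simp
  next
    case (step i)
    show ?case
    proof
      assume i: "1 \<le> i"
      then have "c * (gap p i z - gap p (i + 1) z) \<in> I i"
        using z step.hyps by (auto simp: region_def)
      then have "\<bar>c * (gap p i z - gap p (i + 1) z)\<bar> \<le> M" using i step.hyps by (intro M(1)) auto
      moreover have "\<bar>c * gap p (i + 1) z\<bar> \<le> real (\<nu> - Suc i) * M" using step.IH by simp
      moreover have "c * gap p i z = c * (gap p i z - gap p (i + 1) z) + c * gap p (i + 1) z"
        by (simp add: algebra_simps)
      ultimately have "\<bar>c * gap p i z\<bar> \<le> M + real (\<nu> - Suc i) * M" by linarith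
      also have "\<dots> = real (\<nu> - i) * M" using step.hyps by (simp add: of_nat_diff algebra_simps)
      finally show "\<bar>c * gap p i z\<bar> \<le> real (\<nu> - i) * M" .
    qed
  qed
  then have "\<bar>c * gap p j z\<bar> \<le> real (\<nu> - j) * M" using j by simp
  also have "\<dots> \<le> real \<nu> * M" using M(2) by (intro mult_right_mono) auto
  finally show ?thesis .
qed

lemma primitive_snd_nonzero:
  assumes p: "p \<in> primitive_tuples \<nu>" and j: "j \<in> {1..<\<nu>}" and pos: "den p j z > 0" "snd z > 0"
  shows "snd (p j) \<noteq> 0"
  using primitive_det_nonzero[OF p, of j \<nu> z] j pos den_last[OF p, of z] primitive_tuplesD(3)[OF p]
  by simp

text \<open>
  A bounded gap with denominators at most 1 bounds \<open>B\<^sub>j\<close>. Since \<open>B\<^bsub>\<nu>-1\<^esub>\<close> is a nonzero integer, the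
  bound on its gap keeps \<open>y\<close> away from 0, and then \<open>A\<^sub>j y = den + B\<^sub>j x\<close> bounds \<open>A\<^sub>j\<close>.
  The constant \<open>1/8\<close> is chosen below \<open>3/\<pi>\<^sup>2\<close>, so that the bound covers the limit and all large \<open>Q\<close> at once.
\<close>

lemma index_bound:
  assumes "\<nu> \<ge> 2" and p: "p \<in> primitive_tuples \<nu>" and z: "z \<in> region \<nu> I c p" and c: "c \<ge> 1 / 8"
    and M: "\<And>j t. j \<in> {1..\<nu> - 1} \<Longrightarrow> t \<in> I j \<Longrightarrow> \<bar>t\<bar> \<le> M" "M \<ge> 0" and j: "j \<in> {1..\<nu>}"
  shows "\<bar>of_int (fst (p j))\<bar> \<le> 16 * (real \<nu> * M)" "\<bar>of_int (snd (p j))\<bar> \<le> 16 * (real \<nu> * M)"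
proof -
  define L where "L = 8 * (real \<nu> * M)"
  have L0: "L \<ge> 0" using M(2) by (simp add: L_def)
  obtain x y where xy: "z = (x, y)" by (cases z)
  have den: "0 < den p i z" "den p i z \<le> 1" if "i \<in> {1..\<nu>}" for i
    using z that by (auto simp: region_def)
  have y: "0 < y" "y \<le> 1" "0 \<le> x" "x \<le> y"
    using den[of \<nu>] den_last[OF p, of z] assms(1) z by (auto simp: xy region_def)
  have gL: "\<bar>of_int (snd (p i))\<bar> \<le> L * (y * den p i z)" if i: "i \<in> {1..\<nu>}" for i
  proof -
    have "c * \<bar>gap p i z\<bar> \<le> real \<nu> * M"
      using gap_bound[OF p z M i] c by (simp add: abs_mult)
    moreover have "1 / 8 * \<bar>gap p i z\<bar> \<le> c * \<bar>gap p i z\<bar>" using c by (intro mult_right_mono) auto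
    ultimately have "\<bar>gap p i z\<bar> \<le> L" unfolding L_def by linarith
    moreover have "\<bar>of_int (snd (p i))\<bar> = \<bar>gap p i z\<bar> * (y * den p i z)"
      using den(1)[OF i] y by (simp add: gap_def xy abs_mult)
    ultimately show ?thesis using den(1)[OF i] y by (simp add: mult_right_mono)
  qed
  have sb: "\<bar>of_int (snd (p i))\<bar> \<le> L * y" if i: "i \<in> {1..\<nu>}" for i
  proof -
    have "L * (y * den p i z) \<le> L * (y * 1)"
      using L0 y den[OF i] by (intro mult_left_mono) auto
    then show ?thesis using gL[OF i] by simp
  qed
  have Ly: "1 \<le> L * y"
  proof -
    have i: "\<nu> - 1 \<in> {1..<\<nu>}" using assms(1) by auto
    then have "snd (p (\<nu> - 1)) \<noteq> 0"
      using den[of "\<nu> - 1"] y by (intro primitive_snd_nonzero[OF p, of _ z]) (auto simp: xy)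
    then have "1 \<le> \<bar>snd (p (\<nu> - 1))\<bar>" by linarith
    then have "1 \<le> \<bar>of_int (snd (p (\<nu> - 1))) :: real\<bar>" by linarith
    also have "\<dots> \<le> L * y" using i by (intro sb) auto
    finally show ?thesis .
  qed
  have LyL: "L * y \<le> L" using y L0 by (simp add: mult_left_le)
  show "\<bar>of_int (snd (p j))\<bar> \<le> 16 * (real \<nu> * M)"
    using sb[OF j] LyL L0 by (simp add: L_def)
  have "\<bar>of_int (fst (p j))\<bar> * y = \<bar>of_int (fst (p j)) * y\<bar>" using y by (simp add: abs_mult)
  also have "\<dots> = \<bar>den p j z + of_int (snd (p j)) * x\<bar>" by (simp add: den_def xy)
  also have "\<dots> \<le> \<bar>den p j z\<bar> + \<bar>of_int (snd (p j)) * x\<bar>" by (rule abs_triangle_ineq)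
  also have "\<dots> \<le> L * y + L * y"
  proof (rule add_mono)
    show "\<bar>den p j z\<bar> \<le> L * y" using den[OF j] Ly by simp
    have "\<bar>of_int (snd (p j)) * x\<bar> \<le> (L * y) * 1"
      unfolding abs_mult using sb[OF j] y L0 by (intro mult_mono) auto
    then show "\<bar>of_int (snd (p j)) * x\<bar> \<le> L * y" by simp
  qed
  also have "\<dots> = 2 * L * y" by simp
  finally have "\<bar>of_int (fst (p j))\<bar> \<le> 2 * L" using y by simp
  then show "\<bar>of_int (fst (p j))\<bar> \<le> 16 * (real \<nu> * M)" by (simp add: L_def)
qed

definition bounded_tuples :: "nat \<Rightarrow> real \<Rightarrow> (nat \<Rightarrow> int \<times> int) set" where
  "bounded_tuples \<nu> L = {p \<in> primitive_tuples \<nu>.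
     \<forall>j\<in>{1..\<nu>}. \<bar>of_int (fst (p j))\<bar> \<le> L \<and> \<bar>of_int (snd (p j))\<bar> \<le> L}"

lemma finite_bounded_tuples: "finite (bounded_tuples \<nu> L)"
proof (rule finite_subset)
  show "bounded_tuples \<nu> L \<subseteq> {1..\<nu>} \<rightarrow>\<^sub>E {- \<lceil>L\<rceil>..\<lceil>L\<rceil>} \<times> {- \<lceil>L\<rceil>..\<lceil>L\<rceil>}"
  proof
    fix p assume p: "p \<in> bounded_tuples \<nu> L"
    have "p j \<in> {- \<lceil>L\<rceil>..\<lceil>L\<rceil>} \<times> {- \<lceil>L\<rceil>..\<lceil>L\<rceil>}" if "j \<in> {1..\<nu>}" for j
    proof -
      have "\<bar>of_int (fst (p j))\<bar> \<le> L" "\<bar>of_int (snd (p j))\<bar> \<le> L" using p that by (auto simp: bounded_tuples_def)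
      then have "\<bar>fst (p j)\<bar> \<le> \<lceil>L\<rceil>" "\<bar>snd (p j)\<bar> \<le> \<lceil>L\<rceil>" by linarith+
      then show ?thesis by (auto simp: mem_Times_iff)
    qed
    moreover have "p \<in> extensional {1..\<nu>}"
      using p primitive_tuplesD(1) unfolding bounded_tuples_def by blast
    ultimately show "p \<in> {1..\<nu>} \<rightarrow>\<^sub>E {- \<lceil>L\<rceil>..\<lceil>L\<rceil>} \<times> {- \<lceil>L\<rceil>..\<lceil>L\<rceil>}"
      by (simp add: PiE_def)
  qed
  show "finite ({1..\<nu>} \<rightarrow>\<^sub>E {- \<lceil>L\<rceil>..\<lceil>L\<rceil>} \<times> {- \<lceil>L\<rceil>..\<lceil>L\<rceil>})"
    by (intro finite_PiE) auto
qed

section \<open>Inverses modulo a denominator\<close>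

lemma coprime_of_inverse:
  fixes a m n :: int
  assumes "n dvd a * m - 1"
  shows "coprime a n" "coprime m n"
proof -
  have "is_unit d" if "d dvd a * m" "d dvd n" for d
    using that assms by (metis dvd_diff_right_iff dvd_trans dvd_diff_commute)
  then show "coprime a n" "coprime m n" by (auto intro!: coprimeI)
qed

lemma inverse_mod_unique:
  fixes a a' m n :: nat
  assumes "a \<in> {1..n}" "a' \<in> {1..n}" "int n dvd int a * int m - 1" "int n dvd int a' * int m - 1"
  shows "a = a'"
proof -
  have "int n dvd (int a - int a') * int m"
    using dvd_diff[OF assms(3,4)] by (simp add: algebra_simps)
  then have "int n dvd int a - int a'"
    using coprime_of_inverse(2)[OF assms(3)] by (simp add: coprime_commute coprime_dvd_mult_left_iff)
  moreover have "\<bar>int a - int a'\<bar> < int n" using assms(1,2) by auto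
  ultimately have "int a - int a' = 0" using dvd_imp_le_int[of "int a - int a'" "int n"] by linarith
  then show ?thesis by simp
qed

lemma inverse_mod_exists:
  fixes m n :: nat
  assumes "coprime m n" "n \<ge> 1"
  shows "\<exists>a\<in>{1..n}. int n dvd int a * int m - 1"
proof -
  obtain x y where xy: "x * int m + y * int n = 1"
    using bezout_int[of "int m" "int n"] assms(1) by (auto simp: coprime_iff_gcd_eq_1)
  \<comment> \<open>Shift by 1, so that the residue lies in \<open>{1..n}\<close>.\<close>
  define r where "r = (x - 1) mod int n + 1"
  have r: "1 \<le> r" "r \<le> int n" using assms(2) by (auto simp: r_def pos_mod_bound add1_zle_eq)
  have "r = x - int n * ((x - 1) div int n)"
    by (simp add: r_def minus_div_mult_eq_mod[symmetric] algebra_simps)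
  then have "r * int m - 1 = int n * (- y - ((x - 1) div int n) * int m)"
    using xy by algebra
  then have "int n dvd r * int m - 1" by simp
  with r show ?thesis by (intro bexI[of _ "nat r"]) auto
qed

text \<open>
  The representative in \<open>{1..n}\<close>, rather than \<open>{0..<n}\<close>, is the one that is a Farey numerator also for \<open>n = 1\<close>.
\<close>

definition inv_mod :: "nat \<Rightarrow> nat \<Rightarrow> nat" where
  "inv_mod m n = (SOME a. a \<in> {1..n} \<and> int n dvd int a * int m - 1)"

lemma inv_mod:
  assumes "coprime m n" "n \<ge> 1"
  shows "inv_mod m n \<in> {1..n}" "int n dvd int (inv_mod m n) * int m - 1"
proof -
  have "\<exists>a. a \<in> {1..n} \<and> int n dvd int a * int m - 1" using inverse_mod_exists[OF assms] by blast
  from someI_ex[OF this] show "inv_mod m n \<in> {1..n}" "int n dvd int (inv_mod m n) * int m - 1"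
    unfolding inv_mod_def by blast+
qed

lemma inv_mod_eqI:
  assumes "a \<in> {1..n}" "int n dvd int a * int m - 1"
  shows "inv_mod m n = a"
proof -
  have cop: "coprime m n" using coprime_of_inverse(2)[OF assms(2)] by simp
  have n: "n \<ge> 1" using assms(1) by auto
  show ?thesis
    by (rule inverse_mod_unique[OF inv_mod(1)[OF cop n] assms(1) inv_mod(2)[OF cop n] assms(2)])
qed

section \<open>Correlated Farey tuples as lattice points\<close>

text \<open>
  The representative modulo 1 in \<open>(0, 1]\<close>, the range of the Farey fractions.
\<close>

definition frac1 :: "real \<Rightarrow> real" where
  "frac1 t = t - of_int (\<lceil>t\<rceil> - 1)"

lemma frac1_range: "frac1 t \<in> {0<..1}"
  unfolding frac1_def by (simp, linarith)

lemma frac1_eqI: "t - of_int k \<in> {0<..1} \<Longrightarrow> frac1 t = t - of_int k"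
proof -
  assume "t - of_int k \<in> {0<..1}"
  then have "\<lceil>t\<rceil> = k + 1" by (auto simp: ceiling_eq_iff)
  then show ?thesis by (simp add: frac1_def)
qed

lemma frac1_eqD:
  assumes "frac1 s = frac1 t" "\<bar>s - t\<bar> < 1"
  shows "s = t"
proof -
  have "s - t = of_int (\<lceil>s\<rceil> - \<lceil>t\<rceil>)" using assms(1) by (simp add: frac1_def)
  moreover from this assms(2) have "\<bar>real_of_int (\<lceil>s\<rceil> - \<lceil>t\<rceil>)\<bar> < 1" by simp
  then have "\<lceil>s\<rceil> - \<lceil>t\<rceil> = 0" by linarith
  ultimately show ?thesis by simp
qed

text \<open>
  The \<open>j\<close>-th fraction before reduction modulo 1: the last entry plus its gap.
\<close>

definition lift_point :: "(nat \<Rightarrow> int \<times> int) \<Rightarrow> nat \<Rightarrow> nat \<Rightarrow> nat \<Rightarrow> real" where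
  "lift_point p m n j = real (inv_mod m n) / real n + gap p j (real m, real n)"

definition farey_tuple :: "nat \<Rightarrow> (nat \<Rightarrow> int \<times> int) \<times> nat \<times> nat \<Rightarrow> nat \<Rightarrow> real" where
  "farey_tuple \<nu> = (\<lambda>(p, m, n). \<lambda>j\<in>{1..\<nu>}. frac1 (lift_point p m n j))"

lemma den_scale: "den p j (x / t, y / t) = den p j (x, y) / t"
  by (simp add: den_def diff_divide_distrib)

lemma gap_scale: "gap p j (x / t, y / t) = t\<^sup>2 * gap p j (x, y)"
  by (simp add: gap_def den_scale power2_eq_square)

lemma scaled_mem_region_iff:
  assumes "t > 0"
  shows "(x / t, y / t) \<in> region \<nu> I (N / t\<^sup>2) p \<longleftrightarrow>
     0 \<le> x \<and> x \<le> y \<and> (\<forall>j\<in>{1..\<nu>}. 0 < den p j (x, y) \<and> den p j (x, y) \<le> t) \<and>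
     (\<forall>j\<in>{1..\<nu> - 1}. N * (gap p j (x, y) - gap p (j + 1) (x, y)) \<in> I j)"
proof -
  have "N / t\<^sup>2 * (gap p j (x / t, y / t) - gap p i (x / t, y / t)) = N * (gap p j (x, y) - gap p i (x, y))" for i j
    using assms by (simp add: gap_scale right_diff_distrib)
  then show ?thesis
    using assms by (simp add: region_def den_scale divide_le_cancel zero_less_divide_iff zero_le_divide_iff)
qed

lemma gap_eq_imp:
  assumes "p j = (a, b)" "p' j = (a', b')" "coprime a b" "coprime a' b'"
    and pos: "den p j (x, y) > 0" "den p' j (x, y) > 0" "y > 0"
    and "gap p j (x, y) = gap p' j (x, y)"
  shows "p j = p' j"
proof -
  have "real_of_int b / den p j (x, y) = y * gap p j (x, y)"
    "real_of_int b' / den p' j (x, y) = y * gap p' j (x, y)"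
    using pos(3) by (simp_all add: gap_def assms(1,2))
  then have "real_of_int b / den p j (x, y) = of_int b' / den p' j (x, y)"
    using assms(8) by simp
  then have "real_of_int b * den p' j (x, y) = of_int b' * den p j (x, y)"
    using pos by (simp add: field_simps)
  then have "y * of_int (b * a') = y * of_int (b' * a)"
    using assms(1,2) by (simp add: den_def algebra_simps)
  then have "b * a' = b' * a" using pos(3) by (simp only: mult_cancel_left of_int_eq_iff) auto
  then show ?thesis
    using parallel_primitive[OF assms(3,4), of y x] pos assms(1,2) by (simp add: den_def)
qed

text \<open>
  The numerator is the first coordinate of \<open>A (a, n) - B ((a m - 1)/n, m)\<close>.
\<close>

lemma lift_point_rational:
  assumes cop: "coprime m n" and n: "n \<ge> 1" and q: "den p j (real m, real n) > 0"
  shows "\<exists>u. lift_point p m n j =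
    of_int u / of_int (fst (p j) * int n - snd (p j) * int m)"
proof -
  obtain A B where AB: "p j = (A, B)" by (cases "p j")
  define a where "a = int (inv_mod m n)"
  obtain a' where a': "a * int m - 1 = int n * a'"
    using inv_mod(2)[OF cop n] by (auto simp: a_def elim: dvdE)
  define Q where "Q = A * int n - B * int m"
  have Q: "den p j (real m, real n) = of_int Q" by (simp add: den_def AB Q_def)
  have "int n * (A * a - B * a') = a * Q + B"
    using a' by (simp add: Q_def algebra_simps)
  then have "real_of_int (int n * (A * a - B * a')) = of_int (a * Q + B)" by presburger
  then have e: "real n * of_int (A * a - B * a') = of_int a * of_int Q + of_int B" by simp
  have "lift_point p m n j = of_int a / real n + of_int B / (real n * of_int Q)"
    by (simp add: lift_point_def gap_def Q AB a_def)
  also have "\<dots> = (of_int a * of_int Q + of_int B) / (real n * of_int Q)"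
    using q n unfolding Q by (simp add: field_simps)
  also have "\<dots> = of_int (A * a - B * a') / of_int Q"
    using n unfolding e[symmetric] by simp
  finally have "lift_point p m n j = of_int (A * a - B * a') / of_int (fst (p j) * int n - snd (p j) * int m)"
    by (simp only: AB Q_def fst_conv snd_conv)
  then show ?thesis by (rule exI)
qed

definition correlated_tuples :: "nat \<Rightarrow> real set \<Rightarrow> (nat \<Rightarrow> real) set \<Rightarrow> (nat \<Rightarrow> real) set" where
  "correlated_tuples \<nu> F \<B> = {x \<in> {1..\<nu>} \<rightarrow>\<^sub>E F. inj_on x {1..\<nu>} \<and>
       (\<exists>b\<in>\<B>. \<exists>k :: nat \<Rightarrow> int. \<forall>j\<in>{1..\<nu> - 1}.
          x j - x (j + 1) = b j / real (card F) + of_int (k j))}"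

definition lattice_data :: "nat \<Rightarrow> (nat \<Rightarrow> real set) \<Rightarrow> nat \<Rightarrow> (nat \<Rightarrow> int \<times> int) set \<Rightarrow>
    ((nat \<Rightarrow> int \<times> int) \<times> nat \<times> nat) set" where
  "lattice_data \<nu> I Q P = (SIGMA p:P. {(m, n). m \<in> {1..Q} \<and> n \<in> {1..Q} \<and> coprime m n \<and>
     (real m / real Q, real n / real Q) \<in> region \<nu> I (real (card (farey Q)) / (real Q)\<^sup>2) p})"

context
  fixes \<nu> Q :: nat and I :: "nat \<Rightarrow> real set" and M :: real
  assumes \<nu>: "\<nu> \<ge> 2" and Q: "Q \<ge> 1" and M0: "M \<ge> 0"
    and M: "\<And>j t. j \<in> {1..\<nu> - 1} \<Longrightarrow> t \<in> I j \<Longrightarrow> \<bar>t\<bar> \<le> M"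
    and large: "real (card (farey Q)) / (real Q)\<^sup>2 \<ge> 1 / 8" "real (card (farey Q)) > 2 * (real \<nu> * M)"
begin

text \<open>
  The hypothesis on the number of fractions makes every gap smaller than \<open>1/2\<close> in absolute value. This removes the
  ambiguity modulo 1: lifts that agree modulo 1 are equal.
\<close>

lemma lattice_dataD:
  assumes "(p, m, n) \<in> lattice_data \<nu> I Q (bounded_tuples \<nu> L)"
  shows "p \<in> primitive_tuples \<nu>" "1 \<le> m" "m \<le> n" "1 \<le> n" "n \<le> Q" "coprime m n"
    "j \<in> {1..\<nu>} \<Longrightarrow> 0 < den p j (real m, real n)"
    "j \<in> {1..\<nu>} \<Longrightarrow> den p j (real m, real n) \<le> real Q"
    "j \<in> {1..\<nu> - 1} \<Longrightarrow> real (card (farey Q)) *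
       (gap p j (real m, real n) - gap p (j + 1) (real m, real n)) \<in> I j"
    "j \<in> {1..\<nu>} \<Longrightarrow> \<bar>gap p j (real m, real n)\<bar> < 1 / 2"
proof -
  let ?N = "real (card (farey Q))"
  have p: "p \<in> primitive_tuples \<nu>" and mn: "m \<in> {1..Q}" "n \<in> {1..Q}" "coprime m n"
    and r: "(real m / real Q, real n / real Q) \<in> region \<nu> I (?N / (real Q)\<^sup>2) p"
    using assms by (auto simp: lattice_data_def bounded_tuples_def)
  show "p \<in> primitive_tuples \<nu>" "1 \<le> m" "1 \<le> n" "n \<le> Q" "coprime m n" using p mn by auto
  have s: "real m \<le> real n" "\<forall>j\<in>{1..\<nu>}. 0 < den p j (real m, real n) \<and> den p j (real m, real n) \<le> real Q"
     "\<forall>j\<in>{1..\<nu> - 1}. ?N * (gap p j (real m, real n) - gap p (j + 1) (real m, real n)) \<in> I j"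
    using r Q by (simp_all add: scaled_mem_region_iff)
  show "m \<le> n" using s(1) by simp
  show "j \<in> {1..\<nu>} \<Longrightarrow> 0 < den p j (real m, real n)" "j \<in> {1..\<nu>} \<Longrightarrow> den p j (real m, real n) \<le> real Q"
    using s(2) by blast+
  show "j \<in> {1..\<nu> - 1} \<Longrightarrow> ?N * (gap p j (real m, real n) - gap p (j + 1) (real m, real n)) \<in> I j"
    using s(3) by blast
  assume j: "j \<in> {1..\<nu>}"
  have "\<bar>?N / (real Q)\<^sup>2 * gap p j (real m / real Q, real n / real Q)\<bar> \<le> real \<nu> * M"
    by (rule gap_bound[OF p r M M0 j])
  then have "?N * \<bar>gap p j (real m, real n)\<bar> \<le> real \<nu> * M"
    using Q by (simp add: gap_scale abs_mult)
  then have "?N * \<bar>gap p j (real m, real n)\<bar> < ?N * (1 / 2)" using large(2) by simp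
  then show "\<bar>gap p j (real m, real n)\<bar> < 1 / 2"
    using mult_less_cancel_left_pos[of ?N] large(2) M0 by (smt (verit) mult_nonneg_nonneg of_nat_0_le_iff)
qed

lemma farey_tuple_last:
  assumes "(p, m, n) \<in> lattice_data \<nu> I Q (bounded_tuples \<nu> L)"
  shows "farey_tuple \<nu> (p, m, n) \<nu> = real (inv_mod m n) / real n"
proof -
  note d = lattice_dataD[OF assms]
  have "lift_point p m n \<nu> = real (inv_mod m n) / real n"
    using gap_last[OF d(1)] by (simp add: lift_point_def)
  moreover have "inv_mod m n \<in> {1..n}" using inv_mod(1) d by blast
  ultimately show ?thesis
    using \<nu> frac1_eqI[of "lift_point p m n \<nu>" 0] by (simp add: farey_tuple_def)
qed

text \<open>
  The last entry is a reduced fraction and determines \<open>n\<close>, its numerator and hence the inverse \<open>m\<close>. The gaps are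
  then determined without ambiguity modulo 1, and a gap determines its primitive index.
\<close>

lemma inj_on_farey_tuple: "inj_on (farey_tuple \<nu>) (lattice_data \<nu> I Q (bounded_tuples \<nu> L))"
proof (rule inj_onI)
  fix y y'
  assume y: "y \<in> lattice_data \<nu> I Q (bounded_tuples \<nu> L)" "y' \<in> lattice_data \<nu> I Q (bounded_tuples \<nu> L)"
    "farey_tuple \<nu> y = farey_tuple \<nu> y'"
  obtain p m n p' m' n' where yy: "y = (p, m, n)" "y' = (p', m', n')" by (metis prod_cases3)
  note * = y(1,2)[unfolded yy] and eq = y(3)[unfolded yy]
  note d = lattice_dataD[OF *(1)] and d' = lattice_dataD[OF *(2)]
  note a = inv_mod[OF d(6,4)] and a' = inv_mod[OF d'(6,4)]
  have "real (inv_mod m n) / real n = real (inv_mod m' n') / real n'"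
    using farey_tuple_last[OF *(1)] farey_tuple_last[OF *(2)] eq by simp
  then have an: "inv_mod m n = inv_mod m' n' \<and> n = n'"
    by (rule reduced_fraction_unique)
      (use coprime_of_inverse(1)[OF a(2)] coprime_of_inverse(1)[OF a'(2)] d(4) d'(4) in auto)
  have mm: "m = m'"
    by (rule inverse_mod_unique[of _ n _ "inv_mod m n"])
      (use d d' a(2) a'(2) an in \<open>auto simp: mult.commute\<close>)
  have "p j = p' j" if j: "j \<in> {1..\<nu>}" for j
  proof (rule gap_eq_imp)
    show "p j = (fst (p j), snd (p j))" "p' j = (fst (p' j), snd (p' j))" by simp_all
    show "coprime (fst (p j)) (snd (p j))" "coprime (fst (p' j)) (snd (p' j))"
      using primitive_tuplesD(4)[OF d(1) j] primitive_tuplesD(4)[OF d'(1) j] by auto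
    show "0 < den p j (real m, real n)" "0 < den p' j (real m, real n)" "0 < real n"
      using d(7)[OF j] d'(7)[OF j] d(4) mm an by auto
    have "frac1 (lift_point p m n j) = frac1 (lift_point p' m' n' j)"
      using fun_cong[OF eq, of j] j by (simp add: farey_tuple_def)
    moreover have "\<bar>lift_point p m n j - lift_point p' m' n' j\<bar> < 1"
      using d(10)[OF j] d'(10)[OF j] an mm by (simp add: lift_point_def)
    ultimately have "lift_point p m n j = lift_point p' m' n' j" by (rule frac1_eqD)
    then show "gap p j (real m, real n) = gap p' j (real m, real n)"
      using an mm by (simp add: lift_point_def)
  qed
  moreover have "p \<in> extensional {1..\<nu>}" "p' \<in> extensional {1..\<nu>}"
    using primitive_tuplesD(1) d(1) d'(1) by auto
  ultimately have "p = p'" by (intro extensionalityI[of p "{1..\<nu>}" p']) auto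
  then show "y = y'" using mm an yy by simp
qed

lemma farey_tuple_mem:
  assumes "(p, m, n) \<in> lattice_data \<nu> I Q (bounded_tuples \<nu> L)"
  shows "farey_tuple \<nu> (p, m, n) \<in> correlated_tuples \<nu> (farey Q) (Pi\<^sub>E {1..\<nu> - 1} I)"
proof -
  note d = lattice_dataD[OF assms]
  let ?x = "farey_tuple \<nu> (p, m, n)" and ?N = "real (card (farey Q))"
  let ?z = "(real m, real n)"
  have N: "?N > 0" using large(2) M0 by (smt (verit) mult_nonneg_nonneg of_nat_0_le_iff)
  have x: "?x j = lift_point p m n j - of_int (\<lceil>lift_point p m n j\<rceil> - 1)" if "j \<in> {1..\<nu>}" for j
    using that by (simp add: farey_tuple_def frac1_def)
  have "?x j \<in> farey Q" if j: "j \<in> {1..\<nu>}" for j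
  proof -
    define q where "q = fst (p j) * int n - snd (p j) * int m"
    have q: "den p j ?z = of_int q" by (simp add: q_def den_def)
    obtain u where u: "lift_point p m n j = of_int u / of_int q"
      using lift_point_rational[OF d(6,4) d(7)[OF j]] unfolding q_def by blast
    have q0: "q > 0" "q \<le> int Q" using d(7,8)[OF j] unfolding q by linarith+
    show ?thesis
    proof (rule farey_memI)
      show "?x j = of_int (u - (\<lceil>lift_point p m n j\<rceil> - 1) * q) / of_int q"
        using x[OF j] q0(1) by (simp add: u diff_divide_distrib)
      show "?x j \<in> {0<..1}" using frac1_range j by (simp add: farey_tuple_def)
    qed (use q0 in auto)
  qed
  moreover have "?x \<in> extensional {1..\<nu>}" by (simp add: farey_tuple_def)
  ultimately have mem: "?x \<in> {1..\<nu>} \<rightarrow>\<^sub>E farey Q" by (simp add: PiE_def)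
  have inj: "inj_on ?x {1..\<nu>}"
  proof (rule inj_onI, rule ccontr)
    fix i j assume ij: "i \<in> {1..\<nu>}" "j \<in> {1..\<nu>}" and eq: "?x i = ?x j" and ne: "i \<noteq> j"
    have "frac1 (lift_point p m n i) = frac1 (lift_point p m n j)"
      using eq ij by (simp add: farey_tuple_def)
    moreover have "\<bar>lift_point p m n i - lift_point p m n j\<bar> < 1"
      using d(10)[OF ij(1)] d(10)[OF ij(2)] by (simp add: lift_point_def)
    ultimately have "lift_point p m n i = lift_point p m n j" by (rule frac1_eqD)
    then have "gap p i ?z - gap p j ?z = 0" by (simp add: lift_point_def)
    moreover have "gap p i ?z - gap p j ?z =
        of_int (snd (p i) * fst (p j) - snd (p j) * fst (p i)) / (den p i ?z * den p j ?z)"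
      using d(4) d(7)[OF ij(1)] d(7)[OF ij(2)] by (intro gap_diff) auto
    moreover have "snd (p i) * fst (p j) - snd (p j) * fst (p i) \<noteq> 0"
      by (rule primitive_det_nonzero[OF d(1) ij ne d(7)[OF ij(1)] d(7)[OF ij(2)]])
    ultimately show False using d(7)[OF ij(1)] d(7)[OF ij(2)]
      by (simp del: of_int_diff of_int_mult)
  qed
  define b where "b = (\<lambda>j\<in>{1..\<nu> - 1}. ?N * (gap p j ?z - gap p (j + 1) ?z))"
  define k where "k = (\<lambda>j. \<lceil>lift_point p m n (j + 1)\<rceil> - \<lceil>lift_point p m n j\<rceil>)"
  have "b \<in> Pi\<^sub>E {1..\<nu> - 1} I" using d(9) by (auto simp: b_def)
  moreover have "\<forall>j\<in>{1..\<nu> - 1}. ?x j - ?x (j + 1) = b j / ?N + of_int (k j)"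
  proof
    fix j assume j: "j \<in> {1..\<nu> - 1}"
    then have jj: "j \<in> {1..\<nu>}" "j + 1 \<in> {1..\<nu>}" by auto
    show "?x j - ?x (j + 1) = b j / ?N + of_int (k j)"
      unfolding x[OF jj(1)] x[OF jj(2)] using j N by (simp add: b_def k_def lift_point_def)
  qed
  ultimately show ?thesis using mem inj unfolding correlated_tuples_def by blast
qed

text \<open>
  Given a tuple, the integers \<open>k\<close> are summed to lift all entries near the last one. The indices are the coordinates of
  the lifted primitive vectors \<open>(w j, q j)\<close> in the basis \<open>(a, n)\<close>, \<open>(a', m)\<close> of determinant 1.
\<close>

lemma farey_tuple_surj:
  assumes "x \<in> correlated_tuples \<nu> (farey Q) (Pi\<^sub>E {1..\<nu> - 1} I)"
  shows "x \<in> farey_tuple \<nu> ` lattice_data \<nu> I Q (bounded_tuples \<nu> (16 * (real \<nu> * M)))"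
proof -
  let ?N = "real (card (farey Q))"
  have N: "?N > 0" using large(2) M0 by (smt (verit) mult_nonneg_nonneg of_nat_0_le_iff)
  obtain b k where x: "x \<in> {1..\<nu>} \<rightarrow>\<^sub>E farey Q" "inj_on x {1..\<nu>}" and b: "b \<in> Pi\<^sub>E {1..\<nu> - 1} I"
    and bk: "\<And>j. j \<in> {1..\<nu> - 1} \<Longrightarrow> x j - x (j + 1) = b j / ?N + of_int (k j)"
    using assms unfolding correlated_tuples_def by blast
  define K where "K = (\<lambda>j. \<Sum>i\<in>{j..<\<nu>}. k i)"
  define v where "v = (\<lambda>j. \<Sum>i\<in>{j..<\<nu>}. b i)"
  have Kv: "K j = k j + K (j + 1)" "v j = b j + v (j + 1)" if "j \<in> {1..\<nu> - 1}" for j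
  proof -
    have "j < \<nu>" using that by auto
    then show "K j = k j + K (j + 1)" "v j = b j + v (j + 1)"
      unfolding K_def v_def by (simp_all add: sum.atLeast_Suc_lessThan)
  qed
  have xj: "x j - of_int (K j) = x \<nu> + v j / ?N" if "j \<in> {1..\<nu>}" for j
  proof -
    have "j \<le> \<nu>" using that by simp
    then have "1 \<le> j \<longrightarrow> x j - of_int (K j) = x \<nu> + v j / ?N"
    proof (induction rule: inc_induct)
      case base
      show ?case by (simp add: K_def v_def)
    next
      case (step i)
      show ?case
      proof
        assume "1 \<le> i"
        then have i: "i \<in> {1..\<nu> - 1}" using step.hyps by auto
        show "x i - of_int (K i) = x \<nu> + v i / ?N"
          using step.IH bk[OF i] Kv[OF i] by (simp add: add_divide_distrib)
      qed
    qed
    then show ?thesis using that by simp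
  qed
  have "\<forall>j\<in>{1..\<nu>}. \<exists>\<alpha> q. x j = real \<alpha> / real q \<and> 1 \<le> \<alpha> \<and> \<alpha> \<le> q \<and> q \<le> Q \<and> coprime \<alpha> q"
    using x(1) unfolding farey_def by (auto simp: PiE_iff)
  then obtain \<alpha> q where aq: "\<And>j. j \<in> {1..\<nu>} \<Longrightarrow>
      x j = real (\<alpha> j) / real (q j) \<and> 1 \<le> \<alpha> j \<and> \<alpha> j \<le> q j \<and> q j \<le> Q \<and> coprime (\<alpha> j) (q j)"
    by metis
  define a n where "a = \<alpha> \<nu>" and "n = q \<nu>"
  have an: "x \<nu> = real a / real n" "1 \<le> a" "a \<le> n" "n \<le> Q" "coprime a n"
    using aq[of \<nu>] \<nu> by (auto simp: a_def n_def)
  then have n1: "n \<ge> 1" by simp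
  define m where "m = inv_mod a n"
  have m: "m \<in> {1..n}" "int n dvd int m * int a - 1"
    using inv_mod[OF an(5) n1] by (simp_all add: m_def)
  have inv: "inv_mod m n = a" using an m by (intro inv_mod_eqI) (auto simp: mult.commute)
  have cop: "coprime m n" using coprime_of_inverse(1)[OF m(2)] by simp
  obtain a' where a': "int m * int a - 1 = int n * a'" using m(2) by (auto elim: dvdE)
  define w where "w = (\<lambda>j. int (\<alpha> j) - K j * int (q j))"
  \<comment> \<open>The coordinates of \<open>(w j, q j)\<close>, by Cramer's rule.\<close>
  define p where "p = (\<lambda>j\<in>{1..\<nu>}. (w j * int m - int (q j) * a', w j * int n - int a * int (q j)))"
  let ?z = "(real m, real n)"
  have pj: "fst (p j) = w j * int m - int (q j) * a'" "snd (p j) = w j * int n - int a * int (q j)"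
    if "j \<in> {1..\<nu>}" for j using that by (simp_all add: p_def)
  have q0: "q j > 0" if "j \<in> {1..\<nu>}" for j using aq[OF that] by simp
  have qj: "fst (p j) * int n - snd (p j) * int m = int (q j)" if j: "j \<in> {1..\<nu>}" for j
    unfolding pj[OF j] using a' by algebra
  have wj: "fst (p j) * int a - snd (p j) * a' = w j" if j: "j \<in> {1..\<nu>}" for j
    unfolding pj[OF j] using a' by algebra
  have den: "den p j ?z = real (q j)" if j: "j \<in> {1..\<nu>}" for j
  proof -
    have "den p j ?z = of_int (fst (p j) * int n - snd (p j) * int m)" by (simp add: den_def)
    then show ?thesis using qj[OF j] by simp
  qed
  have wx: "x j - of_int (K j) = of_int (w j) / real (q j)" if j: "j \<in> {1..\<nu>}" for j
    using aq[OF j] q0[OF j] by (simp add: w_def diff_divide_distrib)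
  have gap: "gap p j ?z = v j / ?N" if j: "j \<in> {1..\<nu>}" for j
  proof -
    have "gap p j ?z = of_int (w j * int n - int a * int (q j)) / (real n * real (q j))"
      unfolding gap_def den[OF j] pj(2)[OF j] by simp
    also have "\<dots> = of_int (w j) / real (q j) - real a / real n"
      using n1 q0[OF j] by (simp add: field_simps)
    also have "\<dots> = v j / ?N" using wx[OF j] xj[OF j] an(1) by simp
    finally show ?thesis .
  qed
  have lift: "lift_point p m n j = x j - of_int (K j)" if j: "j \<in> {1..\<nu>}" for j
    using xj[OF j] an(1) by (simp add: lift_point_def inv gap[OF j])
  have xr: "x j \<in> {0<..1}" if j: "j \<in> {1..\<nu>}" for j
    using PiE_mem[OF x(1) j] farey_subset[of Q] by blast
  have frac: "frac1 (lift_point p m n j) = x j" if j: "j \<in> {1..\<nu>}" for j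
    using frac1_eqI[of "lift_point p m n j" "- K j"] xr[OF j] by (simp add: lift[OF j])
  have prim: "p \<in> primitive_tuples \<nu>"
    unfolding primitive_tuples_def
  proof (intro CollectI conjI ballI)
    show "p \<in> {1..\<nu>} \<rightarrow>\<^sub>E UNIV" by (simp add: p_def)
    show "inj_on p {1..\<nu>}"
    proof (rule inj_onI)
      fix i j assume ij: "i \<in> {1..\<nu>}" "j \<in> {1..\<nu>}" "p i = p j"
      then have "gap p i ?z = gap p j ?z" by (simp add: gap_def den_def)
      then have "lift_point p m n i = lift_point p m n j" by (simp add: lift_point_def)
      then have "x i = x j" using frac ij by metis
      then show "i = j" using x(2) ij by (simp add: inj_on_eq_iff)
    qed
    have nn: "\<nu> \<in> {1..\<nu>}" using \<nu> by simp
    have "w \<nu> = int a" by (simp add: w_def K_def a_def)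
    then show "p \<nu> = (1, 0)"
      using pj[OF nn] a' by (simp add: prod_eq_iff n_def[symmetric] mult.commute)
    fix j assume j: "j \<in> {1..\<nu>}"
    have "coprime (w j) (int (q j))"
    proof (rule coprimeI)
      fix d assume d: "d dvd w j" "d dvd int (q j)"
      then have "d dvd w j + K j * int (q j)" by simp
      then have "d dvd int (\<alpha> j)" by (simp add: w_def)
      moreover have "coprime (int (\<alpha> j)) (int (q j))" using aq[OF j] by simp
      ultimately show "is_unit d" using d(2) by (meson coprime_common_divisor)
    qed
    show "coprime (fst (p j)) (snd (p j))"
    proof (rule coprimeI)
      fix d assume "d dvd fst (p j)" "d dvd snd (p j)"
      then have "d dvd w j" "d dvd int (q j)" unfolding wj[OF j, symmetric] qj[OF j, symmetric] by simp_all
      with \<open>coprime (w j) (int (q j))\<close> show "is_unit d" by (rule coprime_common_divisor)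
    qed
  qed
  have reg: "(real m / real Q, real n / real Q) \<in> region \<nu> I (?N / (real Q)\<^sup>2) p"
  proof -
    have "?N * (gap p j ?z - gap p (j + 1) ?z) \<in> I j" if j: "j \<in> {1..\<nu> - 1}" for j
    proof -
      have jj: "j \<in> {1..\<nu>}" "j + 1 \<in> {1..\<nu>}" using j by auto
      have "?N * (gap p j ?z - gap p (j + 1) ?z) = b j"
        unfolding gap[OF jj(1)] gap[OF jj(2)] using N Kv(2)[OF j]
        by (simp add: diff_divide_distrib[symmetric])
      then show ?thesis using b j by (auto simp: PiE_iff)
    qed
    moreover have "0 < den p j ?z \<and> den p j ?z \<le> real Q" if "j \<in> {1..\<nu>}" for j
      using den[OF that] q0[OF that] aq[OF that] by simp
    ultimately show ?thesis using Q m(1) by (subst scaled_mem_region_iff) auto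
  qed
  have pb: "p \<in> bounded_tuples \<nu> (16 * (real \<nu> * M))"
    using prim index_bound[OF \<nu> prim reg large(1) M M0] by (simp add: bounded_tuples_def)
  have mem: "(p, m, n) \<in> lattice_data \<nu> I Q (bounded_tuples \<nu> (16 * (real \<nu> * M)))"
    using pb m(1) an(4) cop reg n1 by (auto simp: lattice_data_def)
  have "farey_tuple \<nu> (p, m, n) = x"
  proof (rule extensionalityI)
    show "farey_tuple \<nu> (p, m, n) \<in> extensional {1..\<nu>}" by (simp add: farey_tuple_def)
    show "x \<in> extensional {1..\<nu>}" using x(1) by (simp add: PiE_def)
    show "farey_tuple \<nu> (p, m, n) j = x j" if "j \<in> {1..\<nu>}" for j
      using frac[OF that] that by (simp add: farey_tuple_def)
  qed
  then show ?thesis by (intro rev_image_eqI[OF mem]) simp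
qed

lemma correlation_farey_eq:
  "correlation \<nu> (farey Q) (Pi\<^sub>E {1..\<nu> - 1} I) =
     (\<Sum>p\<in>bounded_tuples \<nu> (16 * (real \<nu> * M)).
        real (visible_count Q (region \<nu> I (real (card (farey Q)) / (real Q)\<^sup>2) p))) / real (card (farey Q))"
proof -
  let ?P = "bounded_tuples \<nu> (16 * (real \<nu> * M))"
  have "bij_betw (farey_tuple \<nu>) (lattice_data \<nu> I Q ?P) (correlated_tuples \<nu> (farey Q) (Pi\<^sub>E {1..\<nu> - 1} I))"
  proof (rule bij_betw_imageI[OF inj_on_farey_tuple equalityI])
    show "farey_tuple \<nu> ` lattice_data \<nu> I Q ?P \<subseteq> correlated_tuples \<nu> (farey Q) (Pi\<^sub>E {1..\<nu> - 1} I)"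
    proof
      fix x assume "x \<in> farey_tuple \<nu> ` lattice_data \<nu> I Q ?P"
      then obtain y where y: "y \<in> lattice_data \<nu> I Q ?P" "x = farey_tuple \<nu> y" by (rule imageE)
      obtain p m n where "y = (p, m, n)" by (cases y)
      then show "x \<in> correlated_tuples \<nu> (farey Q) (Pi\<^sub>E {1..\<nu> - 1} I)"
        using farey_tuple_mem y by simp
    qed
    show "correlated_tuples \<nu> (farey Q) (Pi\<^sub>E {1..\<nu> - 1} I) \<subseteq> farey_tuple \<nu> ` lattice_data \<nu> I Q ?P"
      using farey_tuple_surj by (rule subsetI)
  qed
  then have "card (correlated_tuples \<nu> (farey Q) (Pi\<^sub>E {1..\<nu> - 1} I)) = card (lattice_data \<nu> I Q ?P)"
    by (rule bij_betw_same_card[symmetric])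
  also have "\<dots> = (\<Sum>p\<in>?P. visible_count Q (region \<nu> I (real (card (farey Q)) / (real Q)\<^sup>2) p))"
    unfolding lattice_data_def visible_count_def
  proof (rule card_SigmaI[OF finite_bounded_tuples], rule ballI)
    fix p
    show "finite {(m, n). m \<in> {1..Q} \<and> n \<in> {1..Q} \<and> coprime m n \<and>
      (real m / real Q, real n / real Q) \<in> region \<nu> I (real (card (farey Q)) / (real Q)\<^sup>2) p}"
      by (rule finite_subset[of _ "{1..Q} \<times> {1..Q}"]) auto
  qed
  finally show ?thesis by (simp add: correlation_def correlated_tuples_def)
qed

end

section \<open>The limit for an arbitrary box\<close>

lemma region_subset_unit_square:
  assumes "\<nu> \<ge> 1" "p \<in> primitive_tuples \<nu>"
  shows "region \<nu> I c p \<subseteq> {0..1} \<times> {0..1}"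
proof
  fix z assume z: "z \<in> region \<nu> I c p"
  then have "den p \<nu> z \<in> {0<..1}" using assms(1) by (auto simp: region_def)
  then show "z \<in> {0..1} \<times> {0..1}"
    using z den_last[OF assms(2), of z] by (auto simp: region_def mem_Times_iff)
qed

text \<open>
  The correlation is a finite sum of counts of coprime pairs; dividing by \<open>Q\<^sup>2\<close> throughout, each count
  converges by equidistribution and the number of fractions by \<open>LIMSEQ_card_farey\<close>.
\<close>

lemma LIMSEQ_correlation_farey:
  assumes \<nu>: "\<nu> \<ge> 2" and I: "\<And>j. j \<in> {1..\<nu> - 1} \<Longrightarrow> is_interval (I j) \<and> bounded (I j)"
    and M: "M \<ge> 0" "\<And>j t. j \<in> {1..\<nu> - 1} \<Longrightarrow> t \<in> I j \<Longrightarrow> \<bar>t\<bar> \<le> M"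
  shows "(\<lambda>Q. correlation \<nu> (farey Q) (Pi\<^sub>E {1..\<nu> - 1} I)) \<longlonglongrightarrow>
    2 * (\<Sum>p\<in>bounded_tuples \<nu> (16 * (real \<nu> * M)). measure lborel (region \<nu> I (3 / pi\<^sup>2) p))"
proof -
  let ?P = "bounded_tuples \<nu> (16 * (real \<nu> * M))" and ?N = "\<lambda>Q. real (card (farey Q))"
  let ?c = "\<lambda>Q. ?N Q / (real Q)\<^sup>2"
  have lim: "(\<lambda>Q. real (visible_count Q (region \<nu> I (?c Q) p)) / (real Q)\<^sup>2) \<longlonglongrightarrow>
      6 / pi\<^sup>2 * measure lborel (region \<nu> I (3 / pi\<^sup>2) p)" if p: "p \<in> ?P" for p
  proof -
    have p': "p \<in> primitive_tuples \<nu>" using p by (simp add: bounded_tuples_def)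
    show ?thesis
    proof (rule LIMSEQ_visible_count)
      show "region \<nu> I (3 / pi\<^sup>2) p \<in> sets borel"
        using I by (intro measurable_region borel_bounded_interval) auto
      show "region \<nu> I (3 / pi\<^sup>2) p \<subseteq> {0..1} \<times> {0..1}"
        using \<nu> by (intro region_subset_unit_square[OF _ p']) auto
      show "converges_ae (\<lambda>Q. region \<nu> I (?c Q) p) (region \<nu> I (3 / pi\<^sup>2) p)"
        by (rule converges_ae_region[OF p' I LIMSEQ_card_farey]) auto
    qed
  qed
  have "(\<lambda>Q. (\<Sum>p\<in>?P. real (visible_count Q (region \<nu> I (?c Q) p)) / (real Q)\<^sup>2) / ?c Q) \<longlonglongrightarrow>
      (\<Sum>p\<in>?P. 6 / pi\<^sup>2 * measure lborel (region \<nu> I (3 / pi\<^sup>2) p)) / (3 / pi\<^sup>2)"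
    by (intro tendsto_divide tendsto_sum lim LIMSEQ_card_farey) auto
  also have "(\<Sum>p\<in>?P. 6 / pi\<^sup>2 * measure lborel (region \<nu> I (3 / pi\<^sup>2) p)) / (3 / pi\<^sup>2) =
      2 * (\<Sum>p\<in>?P. measure lborel (region \<nu> I (3 / pi\<^sup>2) p))"
    unfolding sum_distrib_left[symmetric] by simp
  finally have main: "(\<lambda>Q. (\<Sum>p\<in>?P. real (visible_count Q (region \<nu> I (?c Q) p)) / (real Q)\<^sup>2) / ?c Q) \<longlonglongrightarrow>
      2 * (\<Sum>p\<in>?P. measure lborel (region \<nu> I (3 / pi\<^sup>2) p))" .
  have "pi\<^sup>2 < 4\<^sup>2" using pi_less_4 by (intro power_strict_mono) auto
  then have "1 / 8 < 3 / pi\<^sup>2" by (simp add: field_simps)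
  then have "\<forall>\<^sub>F Q in sequentially. 1 / 8 < ?c Q" by (rule order_tendstoD[OF LIMSEQ_card_farey])
  \<comment> \<open>Together with more than \<open>Q\<^sup>2/8\<close> fractions, this makes all gaps smaller than \<open>1/2\<close>.\<close>
  moreover have "\<forall>\<^sub>F Q in sequentially. nat \<lceil>16 * (real \<nu> * M)\<rceil> + 1 \<le> Q" by (rule eventually_ge_at_top)
  ultimately have "\<forall>\<^sub>F Q in sequentially.
      (\<Sum>p\<in>?P. real (visible_count Q (region \<nu> I (?c Q) p)) / (real Q)\<^sup>2) / ?c Q =
      correlation \<nu> (farey Q) (Pi\<^sub>E {1..\<nu> - 1} I)"
  proof eventually_elim
    case (elim Q)
    have Q: "Q \<ge> 1" "16 * (real \<nu> * M) < real Q" using elim(2) by linarith+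
    have "?N Q > (real Q)\<^sup>2 / 8" using elim(1) Q(1) by (simp add: field_simps)
    moreover have "(real Q)\<^sup>2 \<ge> real Q" using Q(1) by (simp add: power2_eq_square)
    ultimately have "?N Q > 2 * (real \<nu> * M)" using Q(2) by linarith
    then have "correlation \<nu> (farey Q) (Pi\<^sub>E {1..\<nu> - 1} I) =
        (\<Sum>p\<in>?P. real (visible_count Q (region \<nu> I (?c Q) p))) / ?N Q"
      using elim(1) by (intro correlation_farey_eq[OF \<nu> Q(1) M]) auto
    then show ?case using Q(1) by (simp add: sum_divide_distrib[symmetric])
  qed
  then show ?thesis by (rule Lim_transform_eventually[OF main])
qed

section \<open>Positive boxes\<close>

text \<open>
  The last position carries \<open>(1, 0)\<close>, the index of the reference fraction itself.
\<close>

definition index_tuple :: "nat \<Rightarrow> (nat \<Rightarrow> nat) \<times> (nat \<Rightarrow> nat) \<Rightarrow> nat \<Rightarrow> int \<times> int" where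
  "index_tuple \<nu> = (\<lambda>(A, B). \<lambda>j\<in>{1..\<nu>}. if j = \<nu> then (1, 0) else (int (A j), int (B j)))"

lemma inj_on_index_tuple: "inj_on (index_tuple \<nu>) (coprime_pairs (\<nu> - 1))"
proof (rule inj_onI)
  fix s t assume st: "s \<in> coprime_pairs (\<nu> - 1)" "t \<in> coprime_pairs (\<nu> - 1)"
    and eq: "index_tuple \<nu> s = index_tuple \<nu> t"
  obtain A B A' B' where AB: "s = (A, B)" "t = (A', B')" by (metis surj_pair)
  have ext: "A \<in> extensional {1..\<nu> - 1}" "B \<in> extensional {1..\<nu> - 1}"
    "A' \<in> extensional {1..\<nu> - 1}" "B' \<in> extensional {1..\<nu> - 1}"
    using st by (auto simp: coprime_pairs_def AB PiE_def)
  have "A j = A' j \<and> B j = B' j" if "j \<in> {1..\<nu> - 1}" for j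
  proof -
    have "j \<in> {1..\<nu>}" "j \<noteq> \<nu>" using that by auto
    then show ?thesis using fun_cong[OF eq, of j] by (simp add: index_tuple_def AB)
  qed
  then have "A = A'" "B = B'" using ext by (auto intro: extensionalityI)
  then show "s = t" by (simp add: AB)
qed

lemma gap_decreasing:
  assumes pos: "\<And>j. j \<in> {1..\<nu> - 1} \<Longrightarrow> c * (gap p j z - gap p (j + 1) z) > 0" and "c > 0"
    and "1 \<le> i" "i < j" "j \<le> \<nu>"
  shows "gap p j z < gap p i z"
proof -
  have desc: "gap p (Suc k) z < gap p k z" if "1 \<le> k" "k < \<nu>" for k
    using pos[of k] that \<open>c > 0\<close> by (auto simp: zero_less_mult_iff)
  have "Suc i \<le> j" using \<open>i < j\<close> by simp
  then have "j \<le> \<nu> \<longrightarrow> gap p j z < gap p i z"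
  proof (induction rule: dec_induct)
    case base
    show ?case using desc[of i] \<open>1 \<le> i\<close> by auto
  next
    case (step n)
    then show ?case using desc[of n] \<open>1 \<le> i\<close> by auto
  qed
  then show ?thesis using \<open>j \<le> \<nu>\<close> by simp
qed

context
  fixes \<nu> :: nat and I :: "nat \<Rightarrow> real set" and \<Lambda> c :: real
  assumes \<nu>: "\<nu> \<ge> 2" and c: "c > 0" and \<Lambda>: "\<Lambda> > 0"
    and sub: "Pi\<^sub>E {1..\<nu> - 1} I \<subseteq> {1..\<nu> - 1} \<rightarrow>\<^sub>E {0<..<\<Lambda>}"
begin

text \<open>
  The side conditions of \<open>region\<close> assemble to a point of the box. Arguing through the box instead of its
  sides covers the empty box, whose sides need not lie in \<open>(0, \<Lambda>)\<close>.
\<close>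

lemma region_gaps:
  assumes z: "z \<in> region \<nu> I c p" and j: "j \<in> {1..\<nu> - 1}"
  shows "c * (gap p j z - gap p (j + 1) z) \<in> {0<..<\<Lambda>}"
proof -
  have "(\<lambda>j\<in>{1..\<nu> - 1}. c * (gap p j z - gap p (j + 1) z)) \<in> Pi\<^sub>E {1..\<nu> - 1} I"
    using z by (auto simp: region_def)
  then have "(\<lambda>j\<in>{1..\<nu> - 1}. c * (gap p j z - gap p (j + 1) z)) \<in> {1..\<nu> - 1} \<rightarrow>\<^sub>E {0<..<\<Lambda>}"
    using sub by blast
  from PiE_mem[OF this j] show ?thesis using j by simp
qed

lemma region_gap_decreasing:
  assumes z: "z \<in> region \<nu> I c p" and "1 \<le> i" "i < j" "j \<le> \<nu>"
  shows "gap p j z < gap p i z"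
  by (rule gap_decreasing[OF _ c assms(2-4)]) (use region_gaps[OF z] in auto)

text \<open>
  The definition of \<open>coprime_pairs\<close> allows repeated indices, but these would give equal gaps, whereas the gaps
  decrease strictly; so the region of such an index is empty.
\<close>

lemma index_tuple_primitive:
  assumes AB: "AB \<in> coprime_pairs (\<nu> - 1)" and z: "z \<in> region \<nu> I c (index_tuple \<nu> AB)"
  shows "index_tuple \<nu> AB \<in> primitive_tuples \<nu>"
  unfolding primitive_tuples_def
proof (intro CollectI conjI ballI)
  let ?p = "index_tuple \<nu> AB"
  show "?p \<in> {1..\<nu>} \<rightarrow>\<^sub>E UNIV" by (auto simp: index_tuple_def split: prod.splits)
  show "?p \<nu> = (1, 0)" using \<nu> by (auto simp: index_tuple_def split: prod.splits)
  show "inj_on ?p {1..\<nu>}"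
  proof (rule inj_onI)
    fix i j assume ij: "i \<in> {1..\<nu>}" "j \<in> {1..\<nu>}" "?p i = ?p j"
    then have "gap ?p i z = gap ?p j z" by (simp add: gap_def den_def)
    then show "i = j"
      using region_gap_decreasing[OF z, of i j] region_gap_decreasing[OF z, of j i] ij(1,2)
      by (cases i j rule: linorder_cases) auto
  qed
  fix j assume j: "j \<in> {1..\<nu>}"
  obtain A B where AB': "AB = (A, B)" by (cases AB)
  show "coprime (fst (?p j)) (snd (?p j))"
  proof (cases "j = \<nu>")
    case True
    then show ?thesis using j by (simp add: index_tuple_def AB')
  next
    case False
    then have "j \<in> {1..\<nu> - 1}" using j by auto
    then have "coprime (A j) (B j)" using AB by (auto simp: coprime_pairs_def AB')
    then show ?thesis using False j by (simp add: index_tuple_def AB')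
  qed
qed

text \<open>
  All gaps exceed the last one, which is 0. Hence \<open>B\<^sub>j > 0\<close>, and then \<open>A\<^sub>j > 0\<close> from \<open>A\<^sub>j y = den + B\<^sub>j x\<close>.
\<close>

lemma primitive_eq_index_tuple:
  assumes p: "p \<in> primitive_tuples \<nu>" and z: "z \<in> region \<nu> I c p"
  shows "p \<in> index_tuple \<nu> ` coprime_pairs (\<nu> - 1)"
proof -
  define A where "A = (\<lambda>j\<in>{1..\<nu> - 1}. nat (fst (p j)))"
  define B where "B = (\<lambda>j\<in>{1..\<nu> - 1}. nat (snd (p j)))"
  have "den p \<nu> z > 0" using z \<nu> unfolding region_def by auto
  then have y: "snd z > 0" using den_last[OF p, of z] by simp
  have pos: "snd (p j) > 0" "fst (p j) > 0" if j: "j \<in> {1..\<nu> - 1}" for j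
  proof -
    have jj: "j \<in> {1..\<nu>}" "1 \<le> j" "j < \<nu>" using j by auto
    have d: "den p j z > 0" "fst z \<ge> 0" using z jj by (auto simp: region_def)
    have "gap p j z > 0" using region_gap_decreasing[OF z jj(2,3)] gap_last[OF p] by simp
    then show s: "snd (p j) > 0"
      using mult_pos_pos[OF y d(1)] by (auto simp: gap_def zero_less_divide_iff)
    have "of_int (fst (p j)) * snd z = den p j z + of_int (snd (p j)) * fst z" by (simp add: den_def)
    also have "\<dots> > 0" using d s by (intro add_pos_nonneg) auto
    finally show "fst (p j) > 0" using y by (simp add: zero_less_mult_iff)
  qed
  have "(A, B) \<in> coprime_pairs (\<nu> - 1)"
  proof -
    have "coprime (A j) (B j)" if j: "j \<in> {1..\<nu> - 1}" for j
    proof -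
      have "coprime (fst (p j)) (snd (p j))" using j by (intro primitive_tuplesD(4)[OF p]) auto
      moreover have "fst (p j) = int (A j)" "snd (p j) = int (B j)"
        using pos[OF j] j by (simp_all add: A_def B_def)
      ultimately show ?thesis by simp
    qed
    moreover have "A \<in> {1..\<nu> - 1} \<rightarrow>\<^sub>E {1..}" "B \<in> {1..\<nu> - 1} \<rightarrow>\<^sub>E {1..}"
      using pos by (fastforce simp: A_def B_def)+
    ultimately show ?thesis by (simp add: coprime_pairs_def)
  qed
  moreover have "index_tuple \<nu> (A, B) = p"
  proof (rule extensionalityI)
    show "index_tuple \<nu> (A, B) \<in> extensional {1..\<nu>}" by (simp add: index_tuple_def)
    show "p \<in> extensional {1..\<nu>}" by (rule primitive_tuplesD(1)[OF p])
    fix j assume j: "j \<in> {1..\<nu>}"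
    show "index_tuple \<nu> (A, B) j = p j"
    proof (cases "j = \<nu>")
      case True
      then show ?thesis using j primitive_tuplesD(3)[OF p] by (simp add: index_tuple_def)
    next
      case False
      then have "j \<in> {1..\<nu> - 1}" using j by auto
      then show ?thesis using False j pos[of j] by (simp add: index_tuple_def A_def B_def)
    qed
  qed
  ultimately show ?thesis by (metis imageI)
qed

text \<open>
  The condition \<open>y \<ge> 3/(\<pi>\<^sup>2 \<Lambda>)\<close> is implied by the others: the gap at position \<open>\<nu> - 1\<close>, scaled by
  \<open>3/\<pi>\<^sup>2\<close>, is less than \<open>\<Lambda>\<close>, its numerator \<open>B\<close> is at least 1, and its denominator is at most \<open>y\<close>.
\<close>

lemma Omega_Phi_eq_region:
  assumes AB: "(A, B) \<in> coprime_pairs (\<nu> - 1)" and c_eq: "c = 3 / pi\<^sup>2"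
  shows "Omega (\<nu> - 1) A B \<Lambda> \<inter> Phi (\<nu> - 1) A B -` (Pi\<^sub>E {1..\<nu> - 1} I)
    = region \<nu> I c (index_tuple \<nu> (A, B))"
proof -
  let ?p = "index_tuple \<nu> (A, B)" and ?d = "\<nu> - 1"
  have den: "den ?p j (x, y) = y * real (A j) - x * real (B j)" if "j \<in> {1..?d}" for j x y
  proof -
    have "j \<in> {1..\<nu>}" "j \<noteq> \<nu>" using that by auto
    then show ?thesis by (simp add: den_def index_tuple_def mult.commute)
  qed
  have den\<nu>: "den ?p \<nu> (x, y) = y" and gap\<nu>: "gap ?p \<nu> (x, y) = 0" for x y
    using \<nu> by (simp_all add: gap_def den_def index_tuple_def)
  have T: "T_AB ?d A B (x, y) j = c * gap ?p j (x, y)" if "j \<in> {1..?d}" for j x y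
  proof -
    have "j \<in> {1..\<nu>}" "j \<noteq> \<nu>" using that by auto
    then have "snd (?p j) = int (B j)" by (simp add: index_tuple_def)
    then show ?thesis using that by (simp add: T_AB_def gap_def c_eq den[OF that] mult.commute)
  qed
  have Phi: "Phi ?d A B z = (\<lambda>j\<in>{1..?d}. c * (gap ?p j z - gap ?p (j + 1) z))" for z
  proof
    fix j
    obtain x y where z: "z = (x, y)" by (cases z)
    show "Phi ?d A B z j = (\<lambda>j\<in>{1..?d}. c * (gap ?p j z - gap ?p (j + 1) z)) j"
    proof (cases "j \<in> {1..?d}")
      case True
      show ?thesis
      proof (cases "j < ?d")
        case less: True
        then have "j + 1 \<in> {1..?d}" by auto
        then show ?thesis using True less T[OF True, of x y] T[of "j + 1" x y]
          by (simp add: Phi_def T_lin_def z right_diff_distrib)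
      next
        case False
        then have "j + 1 = \<nu>" using True \<nu> by auto
        then show ?thesis using True False T[OF True, of x y] gap\<nu>[of x y]
          by (simp add: Phi_def T_lin_def z)
      qed
    qed (auto simp: Phi_def T_lin_def)
  qed
  have split: "(\<forall>j\<in>{1..\<nu>}. R j) \<longleftrightarrow> (\<forall>j\<in>{1..?d}. R j) \<and> R \<nu>" for R
  proof -
    have "{1..\<nu>} = insert \<nu> {1..?d}" using \<nu> by auto
    then show ?thesis by auto
  qed
  have "(x, y) \<in> Omega ?d A B \<Lambda> \<inter> Phi ?d A B -` (Pi\<^sub>E {1..?d} I) \<longleftrightarrow> (x, y) \<in> region \<nu> I c ?p" for x y
  proof -
    have "(x, y) \<in> Omega ?d A B \<Lambda> \<inter> Phi ?d A B -` (Pi\<^sub>E {1..?d} I) \<longleftrightarrow>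
       0 \<le> x \<and> x \<le> y \<and> y \<le> 1 \<and> y \<ge> 3 / (pi\<^sup>2 * \<Lambda>) \<and> (\<forall>j\<in>{1..?d}. den ?p j (x, y) \<in> {0<..1}) \<and>
       (\<forall>j\<in>{1..?d}. c * (gap ?p j (x, y) - gap ?p (j + 1) (x, y)) \<in> I j)"
      unfolding Omega_def using Phi[of "(x, y)"] by (simp add: den PiE_iff)
    also have "\<dots> \<longleftrightarrow> (x, y) \<in> region \<nu> I c ?p"
    proof
      assume *: "0 \<le> x \<and> x \<le> y \<and> y \<le> 1 \<and> y \<ge> 3 / (pi\<^sup>2 * \<Lambda>) \<and> (\<forall>j\<in>{1..?d}. den ?p j (x, y) \<in> {0<..1}) \<and>
       (\<forall>j\<in>{1..?d}. c * (gap ?p j (x, y) - gap ?p (j + 1) (x, y)) \<in> I j)"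
      have "0 < 3 / (pi\<^sup>2 * \<Lambda>)" using \<Lambda> by simp
      then have "0 < y" using * by linarith
      then show "(x, y) \<in> region \<nu> I c ?p" unfolding region_def split using * by (simp add: den\<nu>)
    next
      assume r: "(x, y) \<in> region \<nu> I c ?p"
      then have *: "0 \<le> x" "x \<le> y" "0 < y" "y \<le> 1" "\<forall>j\<in>{1..?d}. den ?p j (x, y) \<in> {0<..1}"
       "\<forall>j\<in>{1..?d}. c * (gap ?p j (x, y) - gap ?p (j + 1) (x, y)) \<in> I j"
        unfolding region_def split by (simp_all add: den\<nu>)
      have d: "?d \<in> {1..?d}" "?d + 1 = \<nu>" "?d \<in> {1..\<nu>}" "?d \<noteq> \<nu>" using \<nu> by auto
      have dd: "0 < den ?p ?d (x, y)" "den ?p ?d (x, y) \<le> 1" using *(5) d(1) by auto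
      have "c * gap ?p ?d (x, y) < \<Lambda>"
        using region_gaps[OF r d(1)] unfolding d(2) by (simp add: gap\<nu>)
      moreover have "gap ?p ?d (x, y) = real (B ?d) / (y * den ?p ?d (x, y))"
        using d(3,4) by (simp add: gap_def index_tuple_def)
      moreover have B1: "real (B ?d) \<ge> 1" using AB d(1) by (auto simp: coprime_pairs_def PiE_iff)
      ultimately have "c * real (B ?d) < \<Lambda> * (y * den ?p ?d (x, y))"
        using *(3) dd by (simp add: pos_divide_less_eq)
      also have "\<dots> \<le> \<Lambda> * (y * 1)" using \<Lambda> *(3) dd by (intro mult_left_mono) auto
      finally have "c * real (B ?d) < \<Lambda> * y" by simp
      moreover have "c * 1 \<le> c * real (B ?d)" using c B1 by (intro mult_left_mono) auto
      ultimately have "c \<le> \<Lambda> * y" by linarith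
      then have "y \<ge> 3 / (pi\<^sup>2 * \<Lambda>)" using \<Lambda> by (simp add: c_eq field_simps)
      then show "0 \<le> x \<and> x \<le> y \<and> y \<le> 1 \<and> y \<ge> 3 / (pi\<^sup>2 * \<Lambda>) \<and> (\<forall>j\<in>{1..?d}. den ?p j (x, y) \<in> {0<..1}) \<and>
       (\<forall>j\<in>{1..?d}. c * (gap ?p j (x, y) - gap ?p (j + 1) (x, y)) \<in> I j)"
        using * by blast
    qed
    finally show ?thesis .
  qed
  then show ?thesis by (intro set_eqI) (simp only: split_paired_all)
qed

end

text \<open>
  Both sums run over the same nonempty regions; all other terms vanish.
\<close>

lemma has_sum_area:
  assumes \<nu>: "\<nu> \<ge> 2" and I: "\<And>j. j \<in> {1..\<nu> - 1} \<Longrightarrow> is_interval (I j) \<and> bounded (I j)"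
    and M: "M \<ge> 0" "\<And>j t. j \<in> {1..\<nu> - 1} \<Longrightarrow> t \<in> I j \<Longrightarrow> \<bar>t\<bar> \<le> M"
    and \<Lambda>: "\<Lambda> > 0" and sub: "Pi\<^sub>E {1..\<nu> - 1} I \<subseteq> {1..\<nu> - 1} \<rightarrow>\<^sub>E {0<..<\<Lambda>}"
  shows "((\<lambda>(A, B). measure lebesgue (Omega (\<nu> - 1) A B \<Lambda> \<inter> Phi (\<nu> - 1) A B -` (Pi\<^sub>E {1..\<nu> - 1} I)))
    has_sum (\<Sum>p\<in>bounded_tuples \<nu> (16 * (real \<nu> * M)). measure lborel (region \<nu> I (3 / pi\<^sup>2) p)))
    (coprime_pairs (\<nu> - 1))"
proof -
  let ?P = "bounded_tuples \<nu> (16 * (real \<nu> * M))" and ?c = "3 / pi\<^sup>2" and ?C = "coprime_pairs (\<nu> - 1)"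
  let ?\<mu> = "\<lambda>p. measure lborel (region \<nu> I ?c p)"
  define S where "S = {AB \<in> ?C. index_tuple \<nu> AB \<in> ?P}"
  have c: "?c > 0" by simp
  have "pi\<^sup>2 < 4\<^sup>2" using pi_less_4 by (intro power_strict_mono) auto
  then have c8: "?c \<ge> 1 / 8" by (simp add: field_simps)
  note facts = \<nu> c \<Lambda> sub
  have val: "measure lebesgue (Omega (\<nu> - 1) A B \<Lambda> \<inter> Phi (\<nu> - 1) A B -` (Pi\<^sub>E {1..\<nu> - 1} I))
      = ?\<mu> (index_tuple \<nu> (A, B))" if "(A, B) \<in> ?C" for A B
  proof -
    have "region \<nu> I ?c (index_tuple \<nu> (A, B)) \<in> sets borel"
      using I by (intro measurable_region borel_bounded_interval) auto
    then have "region \<nu> I ?c (index_tuple \<nu> (A, B)) \<in> sets lborel" by simp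
    then show ?thesis
      unfolding Omega_Phi_eq_region[OF facts that refl] by (rule measure_completion)
  qed
  have zero: "?\<mu> (index_tuple \<nu> AB) = 0" if AB: "AB \<in> ?C" "AB \<notin> S" for AB
  proof -
    have "region \<nu> I ?c (index_tuple \<nu> AB) = {}"
    proof (rule equals0I)
      fix z assume z: "z \<in> region \<nu> I ?c (index_tuple \<nu> AB)"
      then have "index_tuple \<nu> AB \<in> primitive_tuples \<nu>"
        by (rule index_tuple_primitive[OF facts AB(1)])
      then have "index_tuple \<nu> AB \<in> ?P"
        using index_bound[OF \<nu> _ z c8 M(2,1)] by (simp add: bounded_tuples_def)
      then show False using AB by (simp add: S_def)
    qed
    then show ?thesis by simp
  qed
  have inj: "inj_on (index_tuple \<nu>) S"
    using inj_on_index_tuple by (rule inj_on_subset) (auto simp: S_def)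
  have "finite (index_tuple \<nu> ` S)"
    by (rule finite_subset[OF _ finite_bounded_tuples]) (auto simp: S_def)
  then have finS: "finite S" using inj by (rule finite_imageD)
  have "((\<lambda>AB. ?\<mu> (index_tuple \<nu> AB)) has_sum (\<Sum>AB\<in>S. ?\<mu> (index_tuple \<nu> AB))) S"
    by (rule has_sum_finite[OF finS])
  also have "(\<Sum>AB\<in>S. ?\<mu> (index_tuple \<nu> AB)) = (\<Sum>p\<in>index_tuple \<nu> ` S. ?\<mu> p)"
    using inj by (simp add: sum.reindex)
  also have "\<dots> = (\<Sum>p\<in>?P. ?\<mu> p)"
  proof (rule sum.mono_neutral_left)
    show "finite ?P" by (rule finite_bounded_tuples)
    show "index_tuple \<nu> ` S \<subseteq> ?P" by (auto simp: S_def)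
    show "\<forall>p\<in>?P - index_tuple \<nu> ` S. ?\<mu> p = 0"
    proof
      fix p assume p: "p \<in> ?P - index_tuple \<nu> ` S"
      have "region \<nu> I ?c p = {}"
      proof (rule equals0I)
        fix z assume z: "z \<in> region \<nu> I ?c p"
        have "p \<in> primitive_tuples \<nu>" using p by (simp add: bounded_tuples_def)
        then have "p \<in> index_tuple \<nu> ` ?C" using z by (rule primitive_eq_index_tuple[OF facts])
        then show False using p by (auto simp: S_def)
      qed
      then show "?\<mu> p = 0" by simp
    qed
  qed
  finally have "((\<lambda>AB. ?\<mu> (index_tuple \<nu> AB)) has_sum (\<Sum>p\<in>?P. ?\<mu> p)) S" .
  also have "?this \<longleftrightarrow> ((\<lambda>(A, B). measure lebesgue (Omega (\<nu> - 1) A B \<Lambda> \<inter>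
      Phi (\<nu> - 1) A B -` (Pi\<^sub>E {1..\<nu> - 1} I))) has_sum (\<Sum>p\<in>?P. ?\<mu> p)) ?C"
  proof (rule has_sum_cong_neutral)
    fix AB
    show "AB \<in> ?C - S \<Longrightarrow> (case AB of (A, B) \<Rightarrow> measure lebesgue (Omega (\<nu> - 1) A B \<Lambda> \<inter>
      Phi (\<nu> - 1) A B -` (Pi\<^sub>E {1..\<nu> - 1} I))) = 0"
      using val zero by (cases AB) auto
    show "AB \<in> S - ?C \<Longrightarrow> ?\<mu> (index_tuple \<nu> AB) = 0" by (auto simp: S_def)
    show "AB \<in> S \<inter> ?C \<Longrightarrow> ?\<mu> (index_tuple \<nu> AB) = (case AB of (A, B) \<Rightarrow>
        measure lebesgue (Omega (\<nu> - 1) A B \<Lambda> \<inter> Phi (\<nu> - 1) A B -` (Pi\<^sub>E {1..\<nu> - 1} I)))"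
      using val by (cases AB) auto
  qed
  finally show ?thesis .
qed

section \<open>The correlation measure\<close>

lemma is_box_bounded_intervals:
  assumes "is_box d \<B>"
  obtains I M where "\<B> = Pi\<^sub>E {1..d} I" "\<forall>j\<in>{1..d}. is_interval (I j) \<and> bounded (I j)"
    "M \<ge> 0" "\<forall>j\<in>{1..d}. \<forall>t\<in>I j. \<bar>t\<bar> \<le> M"
proof -
  obtain I where I: "\<forall>j\<in>{1..d}. is_interval (I j) \<and> bounded (I j)" "\<B> = Pi\<^sub>E {1..d} I"
    using assms unfolding is_box_def by blast
  have "bounded (\<Union>j\<in>{1..d}. I j)" using I(1) by (intro bounded_UN) auto
  then obtain M where M: "M > 0" "\<And>t. t \<in> (\<Union>j\<in>{1..d}. I j) \<Longrightarrow> norm t \<le> M"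
    unfolding bounded_pos by blast
  show ?thesis
  proof (rule that[OF I(2)])
    show "\<forall>j\<in>{1..d}. \<forall>t\<in>I j. \<bar>t\<bar> \<le> M" using M(2) unfolding real_norm_def by blast
  qed (use I M in auto)
qed

theorem theorem1:
  fixes \<nu> :: nat
  assumes "\<nu> \<ge> 2"
  shows "\<exists>R :: (nat \<Rightarrow> real) set \<Rightarrow> real.
    is_correlation_measure \<nu> farey R \<and>
    (\<forall>(\<Lambda>::real) \<B>. \<Lambda> > 0 \<and> is_box (\<nu> - 1) \<B> \<and> \<B> \<subseteq> ({1..\<nu> - 1} \<rightarrow>\<^sub>E {0<..<\<Lambda>}) \<longrightarrow>
      (\<lambda>(A, B). measure lebesgue (Omega (\<nu> - 1) A B \<Lambda> \<inter> Phi (\<nu> - 1) A B -` \<B>))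
        summable_on coprime_pairs (\<nu> - 1) \<and>
      R \<B> = 2 * (\<Sum>\<^sub>\<infinity>(A, B)\<in>coprime_pairs (\<nu> - 1).
        measure lebesgue (Omega (\<nu> - 1) A B \<Lambda> \<inter> Phi (\<nu> - 1) A B -` \<B>)))"
proof (intro exI conjI allI impI)
  let ?R = "\<lambda>\<B>. lim (\<lambda>Q. correlation \<nu> (farey Q) \<B>)"
  show "is_correlation_measure \<nu> farey ?R"
    unfolding is_correlation_measure_def
  proof (intro conjI allI impI)
    show "incseq farey" by (rule incseq_farey)
    show "finite (farey n)" for n by (rule finite_farey)
    show "farey n \<subseteq> {0..1}" for n using farey_subset[of n] by force
    fix \<B> assume "is_box (\<nu> - 1) \<B>"
    then obtain I M where *: "\<B> = Pi\<^sub>E {1..\<nu> - 1} I"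
      "\<forall>j\<in>{1..\<nu> - 1}. is_interval (I j) \<and> bounded (I j)"
      "M \<ge> 0" "\<forall>j\<in>{1..\<nu> - 1}. \<forall>t\<in>I j. \<bar>t\<bar> \<le> M"
      by (rule is_box_bounded_intervals)
    have "convergent (\<lambda>Q. correlation \<nu> (farey Q) \<B>)"
      unfolding *(1) by (rule convergentI[OF LIMSEQ_correlation_farey[OF assms bspec[OF *(2)] *(3) *(4)[rule_format]]])
    then show "(\<lambda>Q. correlation \<nu> (farey Q) \<B>) \<longlonglongrightarrow> ?R \<B>"
      by (simp add: convergent_LIMSEQ_iff)
  qed
  fix \<Lambda> :: real and \<B>
  assume L: "\<Lambda> > 0 \<and> is_box (\<nu> - 1) \<B> \<and> \<B> \<subseteq> ({1..\<nu> - 1} \<rightarrow>\<^sub>E {0<..<\<Lambda>})"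
  then have box: "is_box (\<nu> - 1) \<B>" and pos: "\<Lambda> > 0"
    and sub: "\<B> \<subseteq> {1..\<nu> - 1} \<rightarrow>\<^sub>E {0<..<\<Lambda>}" by blast+
  obtain I M where *: "\<B> = Pi\<^sub>E {1..\<nu> - 1} I"
    "\<forall>j\<in>{1..\<nu> - 1}. is_interval (I j) \<and> bounded (I j)"
    "M \<ge> 0" "\<forall>j\<in>{1..\<nu> - 1}. \<forall>t\<in>I j. \<bar>t\<bar> \<le> M"
    using box by (rule is_box_bounded_intervals)
  have sum: "((\<lambda>(A, B). measure lebesgue (Omega (\<nu> - 1) A B \<Lambda> \<inter> Phi (\<nu> - 1) A B -` \<B>)) has_sum
      (\<Sum>p\<in>bounded_tuples \<nu> (16 * (real \<nu> * M)). measure lborel (region \<nu> I (3 / pi\<^sup>2) p)))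
      (coprime_pairs (\<nu> - 1))"
    unfolding *(1) by (rule has_sum_area[OF assms bspec[OF *(2)] *(3) *(4)[rule_format] pos sub[unfolded *(1)]])
  then show "(\<lambda>(A, B). measure lebesgue (Omega (\<nu> - 1) A B \<Lambda> \<inter> Phi (\<nu> - 1) A B -` \<B>))
        summable_on coprime_pairs (\<nu> - 1)"
    by (rule has_sum_imp_summable)
  have "?R \<B> = 2 * (\<Sum>p\<in>bounded_tuples \<nu> (16 * (real \<nu> * M)). measure lborel (region \<nu> I (3 / pi\<^sup>2) p))"
    unfolding *(1) by (rule limI[OF LIMSEQ_correlation_farey[OF assms bspec[OF *(2)] *(3) *(4)[rule_format]]])
  then show "?R \<B> = 2 * (\<Sum>\<^sub>\<infinity>(A, B)\<in>coprime_pairs (\<nu> - 1).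
        measure lebesgue (Omega (\<nu> - 1) A B \<Lambda> \<inter> Phi (\<nu> - 1) A B -` \<B>))"
    using infsumI[OF sum] by simp
qed

end
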